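(* Consider the affine-in-control switched system $$\dot x=f_\sigma(x)+\sum_{j=1}^m g_{\sigma,j}(x)u_j,\qquad (x(0),\sigma(0))=(x_0,\sigma_0),\quad t\ge0,$$ with controls $u=[u_1,\dots,u_m]^{\mathrm T}$ taking values in $\mathcal U=\mathbb{R}^m$. Suppose that $\sigma$ belongs to class EH with parameters $\lambda>0$ and $q_i\in[0,1]$, $i\in\mathcal P$, and that there exists a family $\{V_i\}_{i\in\mathcal P}$ of twice continuously differentiable real-valued functions on $\mathbb{R}^n$ such that: (C1) there are $\alpha_1,\alpha_2\in\mathcal K_\infty$ with $\alpha_1(\|x\|)\le V_i(x)\le\alpha_2(\|x\|)$ for all $x\in\mathbb{R}^n$, $i\in\mathcal P$; (C2) there is $\mu>1$ with $V_i(x)\le\mu V_j(x)$ for all $x\in\mathbb{R}^n$, $i,j\in\mathcal P$; (C3) there exist $\{\lambda_i\}_{i\in\mathcal P}\subset\mathbb{R}$ such that for all $x\in\mathbb{R}^n\setminus\{0\}$ and all $i\in\mathcal P$, $$\inf_{u\in\mathcal U}\Big\{\mathrm L_{f_i}V_i(x)+\lambda_iV_i(x)+\sum_{j=1}^m u_j\,\mathrm L_{g_{i,j}}V_i(x)\Big\}<0;$$ (C4) for every $\varepsilon>0$ there is $\delta>0$ such that if $x\ne0$ satisfies $\|x\|<\delta$, then there exists $u\in\mathbb{R}^m$ with $\|u\|<\varepsilon$ such that for all $i\in\mathcal P$, $$\mathrm L_{f_i}V_i(x)+\sum_{j=1}^m u_j\,\mathrm L_{g_{i,j}}V_i(x)\le-\lambda_iV_i(x);$$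 (C5) $\lambda_i+\lambda>0$ for all $i\in\mathcal P$, and $\displaystyle\sum_{i\in\mathcal P}\frac{\mu q_i}{1+\lambda_i/\lambda}<1$. Then the feedback control function $\overline k_\sigma(x)=[k_{\sigma,1}(x),\dots,k_{\sigma,m}(x)]^{\mathrm T}$, where $$k_{i,j}(x):=-\mathrm L_{g_{i,j}}V_i(x)\;\varphi\big(\overline W_i(x),\widetilde W_i(x)\big),\quad \overline W_i(x):=\mathrm L_{f_i}V_i(x)+\lambda_iV_i(x),\quad \widetilde W_i(x):=\sum_{j=1}^m\big(\mathrm L_{g_{i,j}}V_i(x)\big)^2,$$ and $$\varphi(a,b):=\begin{cases}\dfrac{a+\sqrt{a^2+b^2}}{b}&\text{if }b\ne0,\\[1ex]0&\text{otherwise,}\end{cases}$$ renders the closed-loop system $$\dot x=f_\sigma(x)+\sum_{j=1}^m g_{\sigma,j}(x)k_{\sigma,j}(x),\qquad (x(0),\sigma(0))=(x_0,\sigma_0),\quad t\ge0,$$ globally asymptotically stable almost surely.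
   Context: Notation: $\mathbb{N}=\{1,2,\dots\}$, $\mathbb{N}_0=\mathbb{N}\cup\{0\}$, $\|\cdot\|$ is the Euclidean norm, and $\mathrm L_fV(x):=\langle\nabla V(x),f(x)\rangle$. A function $\alpha:[0,\infty[\to[0,\infty[$ is of class $\mathcal K$ if it is continuous, strictly increasing and $\alpha(0)=0$; it is of class $\mathcal K_\infty$ if in addition it is unbounded. Setting: $\mathcal P=\{1,\dots,\mathrm N\}$ is a finite index set; $f_i$ and $g_{i,j}$ are twice continuously differentiable vector fields on $\mathbb{R}^n$ with $f_i(0)=0$, $g_{i,j}(0)=0$ for each $i\in\mathcal P$, $j\in\{1,\dots,m\}$. On a complete probability space $(\Omega,\mathfrak F,\mathsf P)$, the switching signal $\sigma=(\sigma(t))_{t\ge0}$ is a càdlàg $\mathcal P$-valued process with $\sigma(0)=\sigma_0$ deterministic. Its switching instants are $0=\tau_0<\tau_1<\tau_2<\cdots$ (almost surely); $\sigma$ is constant on each $[\tau_i,\tau_{i+1}[$, and $\sigma(\tau_i)=\sigma(\tau_{i-1})$ is allowed. The holding times are $S_i:=\tau_i-\tau_{i-1}$, $i\in\mathbb{N}$. The state $x$ does not jump at switching instants, and $x(\cdot)$ denotes the (pathwise, Carathéodory, absolutely continuous) solution of the closed-loop system for the initial state $x_0$; it depends on $x_0$ and $\omega\in\Omega$. Class EH: $\sigma$ belongs to class EH if (EH1) $(S_i)_{i\in\mathbb{N}}$ is i.i.d., each $S_i$ exponential with parameter $\lambda>0$, i.e. $\mathsf P(S_i\le s)=1-e^{-\lambda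 s}$ for $s\ge0$; (EH2) there exist $q_i\in[0,1]$, $i\in\mathcal P$, such that for all $j\in\mathbb{N}$, $\mathsf P\big(\sigma(\tau_j)=i\,\big|\,(\sigma(\tau_k))_{k=0}^{j-1}\big)=q_i$; (EH3) the sequences $(S_i)_{i\in\mathbb{N}}$ and $(\sigma(\tau_i))_{i\in\mathbb{N}_0}$ are mutually independent. Global asymptotic stability almost surely means: (AS1) with probability one, for every $\varepsilon>0$ there is $\delta>0$ such that for every $x_0$, $\|x_0\|<\delta$ implies $\sup_{t\ge0}\|x(t)\|<\varepsilon$; and (AS2) with probability one, for all $r,\varepsilon'>0$ there is $T\ge0$ such that for every $x_0$, $\|x_0\|<r$ implies $\sup_{t\ge T}\|x(t)\|<\varepsilon'$. ($\delta$ and $T$ may depend on $\omega$.) *)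

theory Defs
  imports "HOL-Probability.Probability"
begin

text \<open>Class \<open>C\<^sup>2\<close> on the whole space, with the first and second Frechet derivatives
  as bounded linear maps.\<close>

definition twice_cont_diff :: "('a::real_normed_vector \<Rightarrow> 'b::real_normed_vector) \<Rightarrow> bool" where
  "twice_cont_diff F \<longleftrightarrow>
     (\<exists>(F' :: 'a \<Rightarrow> 'a \<Rightarrow>\<^sub>L 'b) (F'' :: 'a \<Rightarrow> 'a \<Rightarrow>\<^sub>L ('a \<Rightarrow>\<^sub>L 'b)).
        (\<forall>x. (F has_derivative blinfun_apply (F' x)) (at x)) \<and>
        (\<forall>x. (F' has_derivative blinfun_apply (F'' x)) (at x)) \<and>
        continuous_on UNIV F'')"

definition grad :: "('a::real_inner \<Rightarrow> real) \<Rightarrow> 'a \<Rightarrow> 'a" where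
  "grad V x = (THE D. GDERIV V x :> D)"

definition Lie_deriv :: "('a::real_inner \<Rightarrow> 'a) \<Rightarrow> ('a \<Rightarrow> real) \<Rightarrow> 'a \<Rightarrow> real" where
  "Lie_deriv F V x = inner (grad V x) (F x)"

text \<open>Comparison functions are total functions on the reals; only their values on
  \<open>[0,\<infinity>[\<close> matter. Nonnegativity there follows from monotonicity and \<open>\<alpha> 0 = 0\<close>.\<close>

definition class_K :: "(real \<Rightarrow> real) \<Rightarrow> bool" where
  "class_K \<alpha> \<longleftrightarrow> continuous_on {0..} \<alpha> \<and> strict_mono_on {0..} \<alpha> \<and> \<alpha> 0 = 0"

definition class_K_inf :: "(real \<Rightarrow> real) \<Rightarrow> bool" where
  "class_K_inf \<alpha> \<longleftrightarrow> class_K \<alpha> \<and> \<not> bdd_above (\<alpha> ` {0..})"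

definition cadlag :: "(real \<Rightarrow> 'a::topological_space) \<Rightarrow> bool" where
  "cadlag s \<longleftrightarrow>
     (\<forall>t\<ge>0. (s \<longlongrightarrow> s t) (at_right t)) \<and> (\<forall>t>0. \<exists>l. (s \<longlongrightarrow> l) (at_left t))"

text \<open>A cadlag process \<open>\<sigma> t \<omega>\<close> with values in \<open>{1..N}\<close>, together with its switching instants
  \<open>\<tau> i \<omega>\<close>. The instants are part of the data: since \<open>\<sigma>\<close> need not change its value at
  \<open>\<tau> i\<close>, they are not determined by \<open>\<sigma>\<close>.\<close>

definition switching_signal ::
  "'w measure \<Rightarrow> nat \<Rightarrow> (real \<Rightarrow> 'w \<Rightarrow> nat) \<Rightarrow> nat \<Rightarrow> (nat \<Rightarrow> 'w \<Rightarrow> real) \<Rightarrow> bool" where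
  "switching_signal M N \<sigma> \<sigma>0 \<tau> \<longleftrightarrow>
     (\<forall>t\<ge>0. \<sigma> t \<in> measurable M (count_space {1..N})) \<and>
     (\<forall>\<omega>\<in>space M. cadlag (\<lambda>t. \<sigma> t \<omega>)) \<and>
     (\<forall>\<omega>\<in>space M. \<sigma> 0 \<omega> = \<sigma>0) \<and>
     (\<forall>i. \<tau> i \<in> borel_measurable M) \<and>
     (AE \<omega> in M. \<tau> 0 \<omega> = 0 \<and> strict_mono (\<lambda>i. \<tau> i \<omega>) \<and>
        (\<forall>i. \<forall>t\<in>{\<tau> i \<omega>..<\<tau> (Suc i) \<omega>}. \<sigma> t \<omega> = \<sigma> (\<tau> i \<omega>) \<omega>))"

definition holding_time :: "(nat \<Rightarrow> 'w \<Rightarrow> real) \<Rightarrow> nat \<Rightarrow> 'w \<Rightarrow> real" where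
  "holding_time \<tau> i \<omega> = \<tau> i \<omega> - \<tau> (i - 1) \<omega>"

definition mode :: "(real \<Rightarrow> 'w \<Rightarrow> nat) \<Rightarrow> (nat \<Rightarrow> 'w \<Rightarrow> real) \<Rightarrow> nat \<Rightarrow> 'w \<Rightarrow> nat" where
  "mode \<sigma> \<tau> i \<omega> = \<sigma> (\<tau> i \<omega>) \<omega>"

text \<open>The sigma-algebra on \<open>M\<close> generated by \<open>(\<sigma> (\<tau> k))\<close>, \<open>k = 0, \<dots>, j - 1\<close>.\<close>

definition mode_history ::
  "'w measure \<Rightarrow> (real \<Rightarrow> 'w \<Rightarrow> nat) \<Rightarrow> (nat \<Rightarrow> 'w \<Rightarrow> real) \<Rightarrow> nat \<Rightarrow> 'w measure" where
  "mode_history M \<sigma> \<tau> j =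
     vimage_algebra (space M) (\<lambda>\<omega>. \<lambda>k\<in>{..<j}. mode \<sigma> \<tau> k \<omega>)
       (PiM {..<j} (\<lambda>_. count_space UNIV))"

text \<open>In (EH3), independence of the two sequences is independence of the sigma-algebras they
  generate (the constant \<open>prob_space.indep_var\<close> needs both variables to have the same type).\<close>

definition class_EH ::
  "'w measure \<Rightarrow> nat \<Rightarrow> (real \<Rightarrow> 'w \<Rightarrow> nat) \<Rightarrow> (nat \<Rightarrow> 'w \<Rightarrow> real) \<Rightarrow> real \<Rightarrow> (nat \<Rightarrow> real) \<Rightarrow> bool" where
  "class_EH M N \<sigma> \<tau> rate q \<longleftrightarrow>
     \<comment> \<open>(EH1)\<close>
     rate > 0 \<and>
     prob_space.indep_vars M (\<lambda>_. borel) (holding_time \<tau>) {1..} \<and>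
     (\<forall>i\<ge>1. distributed M lborel (holding_time \<tau> i) (exponential_density rate)) \<and>
     \<comment> \<open>(EH2)\<close>
     (\<forall>i\<in>{1..N}. 0 \<le> q i \<and> q i \<le> 1) \<and>
     (\<forall>j\<ge>1. \<forall>i\<in>{1..N}. AE \<omega> in M.
        real_cond_exp M (mode_history M \<sigma> \<tau> j)
          (indicator {\<omega>'\<in>space M. mode \<sigma> \<tau> j \<omega>' = i}) \<omega> = q i) \<and>
     \<comment> \<open>(EH3)\<close>
     prob_space.indep_set M
       (sets (vimage_algebra (space M) (\<lambda>\<omega>. \<lambda>i\<in>{1..}. holding_time \<tau> i \<omega>)
                (PiM {1..} (\<lambda>_. borel))))
       (sets (vimage_algebra (space M) (\<lambda>\<omega> i. mode \<sigma> \<tau> i \<omega>)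
                (PiM UNIV (\<lambda>_. count_space UNIV))))"

text \<open>The elements of a division \<open>D\<close> are nonoverlapping intervals \<open>{Inf K..Sup K}\<close>.\<close>

definition abs_continuous_on :: "real set \<Rightarrow> (real \<Rightarrow> 'a::real_normed_vector) \<Rightarrow> bool" where
  "abs_continuous_on A x \<longleftrightarrow>
     (\<forall>\<epsilon>>0. \<exists>\<delta>>0. \<forall>D. D division_of \<Union>D \<longrightarrow> \<Union>D \<subseteq> A \<longrightarrow> (\<Sum>K\<in>D. Sup K - Inf K) < \<delta> \<longrightarrow>
        (\<Sum>K\<in>D. norm (x (Sup K) - x (Inf K))) < \<epsilon>)"

text \<open>\<open>x\<close> is a global forward Caratheodory solution of \<open>x' = F (s t) x\<close>, \<open>x 0 = x0\<close>;
  its values at negative times are irrelevant.\<close>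

definition caratheodory_solution ::
  "('i \<Rightarrow> 'a::real_normed_vector \<Rightarrow> 'a) \<Rightarrow> (real \<Rightarrow> 'i) \<Rightarrow> 'a \<Rightarrow> (real \<Rightarrow> 'a) \<Rightarrow> bool" where
  "caratheodory_solution F s x0 x \<longleftrightarrow>
     x 0 = x0 \<and>
     (\<forall>T\<ge>0. abs_continuous_on {0..T} x) \<and>
     (AE t in lebesgue_on {0..}. (x has_vector_derivative F (s t) (x t)) (at t))"

text \<open>Global asymptotic stability almost surely. That solutions exist for all \<open>t \<ge> 0\<close> is
  part of the notion, so (AS1) and (AS2) are never vacuous; they are required of every solution,
  so they do not presuppose uniqueness. The null sets do not depend on \<open>x0\<close>.
  The suprema are taken in the extended reals.\<close>

definition GAS_almost_surely ::
  "'w measure \<Rightarrow> ('i \<Rightarrow> 'a::real_normed_vector \<Rightarrow> 'a) \<Rightarrow> (real \<Rightarrow> 'w \<Rightarrow> 'i) \<Rightarrow> bool" where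
  "GAS_almost_surely M F \<sigma> \<longleftrightarrow>
     (AE \<omega> in M. \<forall>x0. \<exists>x. caratheodory_solution F (\<lambda>t. \<sigma> t \<omega>) x0 x) \<and>
     \<comment> \<open>(AS1)\<close>
     (AE \<omega> in M. \<forall>\<epsilon>>0. \<exists>\<delta>>0. \<forall>x0 x.
        caratheodory_solution F (\<lambda>t. \<sigma> t \<omega>) x0 x \<longrightarrow> norm x0 < \<delta> \<longrightarrow>
          (SUP t\<in>{0..}. ereal (norm (x t))) < ereal \<epsilon>) \<and>
     \<comment> \<open>(AS2)\<close>
     (AE \<omega> in M. \<forall>r>0. \<forall>\<epsilon>>0. \<exists>T\<ge>0. \<forall>x0 x.
        caratheodory_solution F (\<lambda>t. \<sigma> t \<omega>) x0 x \<longrightarrow> norm x0 < r \<longrightarrow>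
          (SUP t\<in>{T..}. ereal (norm (x t))) < ereal \<epsilon>)"

definition phi :: "real \<Rightarrow> real \<Rightarrow> real" where
  "phi a b = (if b \<noteq> 0 then (a + sqrt (a\<^sup>2 + b\<^sup>2)) / b else 0)"

definition W_bar ::
  "(nat \<Rightarrow> real^'n \<Rightarrow> real^'n) \<Rightarrow> (nat \<Rightarrow> real^'n \<Rightarrow> real) \<Rightarrow> (nat \<Rightarrow> real) \<Rightarrow>
   nat \<Rightarrow> real^'n \<Rightarrow> real" where
  "W_bar f V lam i x = Lie_deriv (f i) (V i) x + lam i * V i x"

definition W_tilde ::
  "(nat \<Rightarrow> 'm::finite \<Rightarrow> real^'n \<Rightarrow> real^'n) \<Rightarrow> (nat \<Rightarrow> real^'n \<Rightarrow> real) \<Rightarrow>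
   nat \<Rightarrow> real^'n \<Rightarrow> real" where
  "W_tilde g V i x = (\<Sum>j\<in>UNIV. (Lie_deriv (g i j) (V i) x)\<^sup>2)"

definition feedback ::
  "(nat \<Rightarrow> real^'n \<Rightarrow> real^'n) \<Rightarrow> (nat \<Rightarrow> 'm::finite \<Rightarrow> real^'n \<Rightarrow> real^'n) \<Rightarrow>
   (nat \<Rightarrow> real^'n \<Rightarrow> real) \<Rightarrow> (nat \<Rightarrow> real) \<Rightarrow> nat \<Rightarrow> real^'n \<Rightarrow> real^'m" where
  "feedback f g V lam i x =
     (\<chi> j. - Lie_deriv (g i j) (V i) x * phi (W_bar f V lam i x) (W_tilde g V i x))"

definition closed_loop ::
  "(nat \<Rightarrow> real^'n \<Rightarrow> real^'n) \<Rightarrow> (nat \<Rightarrow> 'm::finite \<Rightarrow> real^'n \<Rightarrow> real^'n) \<Rightarrow>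
   (nat \<Rightarrow> real^'n \<Rightarrow> real^'m) \<Rightarrow> nat \<Rightarrow> real^'n \<Rightarrow> real^'n" where
  "closed_loop f g k i x = f i x + (\<Sum>j\<in>UNIV. (k i x $ j) *\<^sub>R g i j x)"

end

theory Submission
  imports Defs "HOL-Complex_Analysis.Great_Picard"
begin

text \<open>Sontag's formula makes every mode dissipative: \<open>L\<^bsub>F i\<^esub> V\<^sub>i \<le> - \<lambda>\<^sub>i V\<^sub>i\<close> along the closed-loop field
  \<open>F i\<close>. On a fixed path, with \<open>Y\<^sub>n\<close> the product of the factors \<open>\<mu> exp (- \<lambda> S\<^sub>k)\<close>, \<open>k \<le> n\<close>, where \<open>\<lambda>\<close>
  is the rate of the mode active during the \<open>k\<close>-th holding time, this gives
  \<open>V (x t) \<le> (Y\<^sub>n + Y\<^bsub>n+1\<^esub>) V (x 0)\<close> between the \<open>n\<close>-th and the next switching instant. The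
  independence assumptions and the exponential law of the holding times bound the expectation of
  \<open>Y\<^sub>n\<close> by a geometric sequence whose ratio is the sum in (C5), so \<open>Y\<^sub>n\<close> is almost surely summable
  and tends to \<open>0\<close>; both parts of stability follow pathwise from this, uniformly in the initial
  state. Only continuity of \<open>F i\<close> is available at the origin, so solutions are obtained from
  Peano's theorem, and the Lyapunov estimate is proved directly for absolutely continuous
  functions.\<close>

subsection \<open>Absolutely continuous functions\<close>

text \<open>The rates \<open>lam i\<close> may be negative, so \<open>V\<close> may grow while such
  a mode is active; contraction is available only in the mean and has to be converted into a
  pathwise statement. The pathwise bound is a product of a random sequence determined by the signal
  alone and a quantity determined by the initial state alone, so one null set serves all initial
  states. Two consecutive terms of \<open>Y\<close> occur because, within a holding interval, the
  exponential lies between its values at the two ends, whatever the sign of the rate.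

  The expectation of \<open>Y n\<close> is computed by splitting over the finitely many mode paths:
  once a path is fixed, the factors are functions of independent holding times. (EH2) says nothing
  about the initial mode, which costs a constant factor but leaves the geometric ratio unchanged.

  At the origin (C4) keeps the feedback bounded, and the vanishing of \<open>g\<close> there gives
  continuity of the closed loop. As Peano's theorem provides no uniqueness, the estimates are proved
  for every solution, not for the constructed one.\<close>

lemma abs_continuous_on_dominated:
  assumes x: "abs_continuous_on A x" and K: "K \<ge> 0"
    and dom: "\<And>u v. u \<in> A \<Longrightarrow> v \<in> A \<Longrightarrow> u \<le> v \<Longrightarrow>
      norm (h v - h u) \<le> K * (norm (x v - x u) + (v - u))"
  shows "abs_continuous_on A h"
  unfolding abs_continuous_on_def
proof (intro allI impI)
  fix e :: real assume e: "e > 0"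
  \<comment> \<open>One \<open>e'\<close> for the increments of \<open>x\<close>, one for the
    lengths; \<open>K + 1\<close> keeps the quotient meaningful when \<open>K = 0\<close>.\<close>
  define e' where "e' = e / (2 * (K + 1))"
  have e': "e' > 0" using e K by (simp add: e'_def)
  obtain d where d: "d > 0" and D: "\<And>D. D division_of \<Union>D \<Longrightarrow> \<Union>D \<subseteq> A \<Longrightarrow> (\<Sum>K\<in>D. Sup K - Inf K) < d \<Longrightarrow>
        (\<Sum>K\<in>D. norm (x (Sup K) - x (Inf K))) < e'"
    using x e' unfolding abs_continuous_on_def by meson
  show "\<exists>\<delta>>0. \<forall>D. D division_of \<Union>D \<longrightarrow> \<Union>D \<subseteq> A \<longrightarrow> (\<Sum>K\<in>D. Sup K - Inf K) < \<delta> \<longrightarrow>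
        (\<Sum>K\<in>D. norm (h (Sup K) - h (Inf K))) < e"
  proof (intro exI[of _ "min d e'"] conjI allI impI)
    show "min d e' > 0" using d e' by simp
    fix D assume div: "D division_of \<Union>D" and sub: "\<Union>D \<subseteq> A"
      and len: "(\<Sum>K\<in>D. Sup K - Inf K) < min d e'"
    have *: "norm (h (Sup J) - h (Inf J)) \<le> K * (norm (x (Sup J) - x (Inf J)) + (Sup J - Inf J))"
      if JD: "J \<in> D" for J
    proof -
      obtain u v where J: "J = cbox u v" "J \<noteq> {}" using division_ofD(3,4)[OF div JD] by blast
      then have "u \<le> v" by auto
      then have "Inf J = u" "Sup J = v" "u \<in> J" "v \<in> J" using J by auto
      then show ?thesis using dom[of u v] sub JD \<open>u \<le> v\<close> by auto
    qed
    have "(\<Sum>J\<in>D. norm (h (Sup J) - h (Inf J)))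
        \<le> (\<Sum>J\<in>D. K * (norm (x (Sup J) - x (Inf J)) + (Sup J - Inf J)))"
      by (rule sum_mono) (rule *)
    also have "\<dots> = K * ((\<Sum>J\<in>D. norm (x (Sup J) - x (Inf J))) + (\<Sum>J\<in>D. Sup J - Inf J))"
      by (simp only: sum.distrib sum_distrib_left[symmetric])
    also have "\<dots> \<le> K * (e' + e')"
      using D[OF div sub] len K by (intro mult_left_mono add_mono) auto
    also have "\<dots> < (K + 1) * (e' + e')" using e' by simp
    also have "\<dots> = e" using K by (simp add: e'_def divide_simps)
    finally show "(\<Sum>K\<in>D. norm (h (Sup K) - h (Inf K))) < e" .
  qed
qed

lemma abs_continuous_on_subset:
  "abs_continuous_on B x \<Longrightarrow> A \<subseteq> B \<Longrightarrow> abs_continuous_on A x"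
  unfolding abs_continuous_on_def by (meson subset_trans)

lemma lipschitz_imp_abs_continuous_on:
  assumes "L-lipschitz_on A x"
  shows "abs_continuous_on A x"
proof (rule abs_continuous_on_dominated[where x = "\<lambda>_. 0 :: real" and K = L])
  show "abs_continuous_on A (\<lambda>_. 0 :: real)"
    unfolding abs_continuous_on_def by (auto intro: exI[of _ 1])
  show "L \<ge> 0" using assms lipschitz_on_nonneg by auto
  show "norm (x v - x u) \<le> L * (norm (0 - 0 :: real) + (v - u))"
    if "u \<in> A" "v \<in> A" "u \<le> v" for u v
    using lipschitz_onD[OF assms, of v u] that by (simp add: dist_norm)
qed

lemma abs_continuous_on_imp_continuous_on:
  assumes x: "abs_continuous_on {a..b} x"
  shows "continuous_on {a..b} x"
  unfolding continuous_on_iff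
proof (intro ballI allI impI)
  fix t e :: real assume t: "t \<in> {a..b}" and e: "0 < e"
  obtain d where d: "d > 0" and D: "\<And>D. D division_of \<Union>D \<Longrightarrow> \<Union>D \<subseteq> {a..b} \<Longrightarrow> (\<Sum>K\<in>D. Sup K - Inf K) < d \<Longrightarrow>
        (\<Sum>K\<in>D. norm (x (Sup K) - x (Inf K))) < e"
    using x e unfolding abs_continuous_on_def by meson
  \<comment> \<open>A single interval is a division, so the definition applies to one
    increment.\<close>
  have *: "norm (x v - x u) < e" if "a \<le> u" "u \<le> v" "v \<le> b" "v - u < d" for u v
    using D[of "{cbox u v}"] that division_of_self[of u v] by auto
  show "\<exists>d>0. \<forall>s\<in>{a..b}. dist s t < d \<longrightarrow> dist (x s) (x t) < e"
  proof (intro exI[of _ d] conjI ballI impI)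
    fix s assume s: "s \<in> {a..b}" "dist s t < d"
    then show "dist (x s) (x t) < e"
      using *[of s t] *[of t s] t by (cases "s \<le> t") (auto simp: dist_norm norm_minus_commute)
  qed (use d in auto)
qed

text \<open>The null set is covered by an open set of small measure; a gauge-fine tagged division then
  separates the tags where the derivative controls the increment from those where absolute
  continuity does.\<close>

lemma abs_continuous_on_nonincreasing:
  fixes h :: "real \<Rightarrow> real"
  assumes ac: "abs_continuous_on {a..b} h" and ab: "a \<le> b" and E: "negligible E"
    and der: "\<And>t. t \<in> {a..b} - E \<Longrightarrow>
      \<exists>d\<le>0. (h has_vector_derivative d) (at t within {a..b})"
  shows "h b \<le> h a"
proof -
  \<comment> \<open>The summand \<open>e\<close> pays for the tags in \<open>E\<close>, and
    \<open>e * (b - a)\<close> for the other tags.\<close>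
  have main: "h b - h a \<le> e + e * (b - a)" if e: "e > 0" for e
  proof -
    obtain d where d: "d > 0" and D: "\<And>D. D division_of \<Union>D \<Longrightarrow> \<Union>D \<subseteq> {a..b} \<Longrightarrow> (\<Sum>K\<in>D. Sup K - Inf K) < d \<Longrightarrow>
        (\<Sum>K\<in>D. norm (h (Sup K) - h (Inf K))) < e"
      using ac e unfolding abs_continuous_on_def by meson
    have Els: "E \<in> sets lebesgue" "emeasure lebesgue E = 0"
      using E by (auto simp: negligible_iff_null_sets null_sets_def)
    obtain U where U: "open U" "E \<subseteq> U" "U - E \<in> lmeasurable" "emeasure lebesgue (U - E) < ennreal d"
      using sets_lebesgue_outer_open[OF Els(1) d] by metis
    have Um: "U \<in> sets lebesgue" using U(1) by auto
    have "emeasure lebesgue U \<le> emeasure lebesgue (U - E) + emeasure lebesgue E"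
      by (rule order_trans[OF emeasure_mono emeasure_subadditive]) (use Um Els in auto)
    then have Ud: "emeasure lebesgue U < ennreal d" using U(4) Els by simp
    then have Ul: "U \<in> lmeasurable" using Um by (auto simp: fmeasurable_def intro: less_trans)
    have Umeas: "measure lebesgue U < d"
      using Ud d by (simp add: emeasure_eq_measure2[OF Ul] ennreal_less_iff)
    \<comment> \<open>At a tag outside \<open>E\<close> the interval straddles the tag, so the
      derivative at \<open>t\<close> controls \<open>h v - h t\<close> and \<open>h t - h u\<close>
      separately, and the two errors add up to \<open>e * (v - u)\<close>.\<close>
    have "\<exists>r>0. (t \<in> E \<longrightarrow> ball t r \<subseteq> U) \<and>
        (t \<in> {a..b} - E \<longrightarrow> (\<forall>u v. u \<in> ball t r \<inter> {a..b} \<and> v \<in> ball t r \<inter> {a..b} \<and> u \<le> t \<and> t \<le> v \<longrightarrow>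
          h v - h u \<le> e * (v - u)))" for t
    proof (cases "t \<in> {a..b} - E")
      case True
      obtain c where c: "c \<le> 0" "(h has_vector_derivative c) (at t within {a..b})" using der[OF True] by blast
      then have "\<exists>r>0. \<forall>y\<in>{a..b}. norm (y - t) < r \<longrightarrow> norm (h y - h t - (y - t) *\<^sub>R c) \<le> e * norm (y - t)"
        unfolding has_vector_derivative_def has_derivative_within_alt using e by blast
      then obtain r where r: "r > 0"
        "\<And>y. y \<in> {a..b} \<Longrightarrow> norm (y - t) < r \<Longrightarrow> norm (h y - h t - (y - t) *\<^sub>R c) \<le> e * norm (y - t)" by blast
      have "h v - h u \<le> e * (v - u)" if "u \<in> ball t r" "u \<in> {a..b}" "v \<in> ball t r" "v \<in> {a..b}" "u \<le> t" "t \<le> v" for u v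
      proof -
        have "\<bar>h u - h t - (u - t) * c\<bar> \<le> e * (t - u)" "\<bar>h v - h t - (v - t) * c\<bar> \<le> e * (v - t)"
          using r(2)[of u] r(2)[of v] that by (auto simp: dist_real_def)
        moreover have "(v - t) * c \<le> 0" "0 \<le> (u - t) * c"
          using that c(1) by (auto intro: mult_nonneg_nonpos mult_nonpos_nonpos)
        ultimately show ?thesis by (simp add: right_diff_distrib)
      qed
      then show ?thesis using r(1) True by (intro exI[of _ r]) auto
    next
      case False
      then show ?thesis using U(1,2) by (cases "t \<in> E") (auto simp: open_contains_ball intro: exI[of _ 1])
    qed
    then obtain r where r0: "\<And>t. r t > 0" and rE: "\<And>t. t \<in> E \<Longrightarrow> ball t (r t) \<subseteq> U"
      and rN: "\<And>t u v. t \<in> {a..b} - E \<Longrightarrow> u \<in> ball t (r t) \<inter> {a..b} \<Longrightarrow> v \<in> ball t (r t) \<inter> {a..b} \<Longrightarrow> u \<le> t \<Longrightarrow> t \<le> v \<Longrightarrow>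
          h v - h u \<le> e * (v - u)"
      by metis
    have "gauge (\<lambda>t. ball t (r t))" using r0 by (auto simp: gauge_def)
    then obtain p where p: "p tagged_division_of {a..b}" and fine: "(\<lambda>t. ball t (r t)) fine p"
      using fine_division_exists_real by blast
    define P where "P = {tk \<in> p. fst tk \<in> E}"
    define Q where "Q = {tk \<in> p. fst tk \<notin> E}"
    have fin: "finite p" using p by auto
    have split: "p = P \<union> Q" "P \<inter> Q = {}" "finite P" "finite Q" "P \<subseteq> p" "Q \<subseteq> p"
      using fin by (auto simp: P_def Q_def)
    have iv: "\<exists>u v. k = cbox u v \<and> u \<le> v \<and> Inf k = u \<and> Sup k = v \<and> u \<le> t \<and> t \<le> v \<and> u \<in> {a..b} \<and> v \<in> {a..b} \<and> t \<in> {a..b}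
        \<and> u \<in> ball t (r t) \<and> v \<in> ball t (r t)" if tk: "(t, k) \<in> p" for t k
    proof -
      obtain u v where k: "k = cbox u v" using tagged_division_ofD(4)[OF p tk] by blast
      have t: "t \<in> k" and sub: "k \<subseteq> {a..b}" using tagged_division_ofD(2,3)[OF p that] by auto
      have kb: "k \<subseteq> ball t (r t)" using fine that by (auto simp: fine_def)
      from t k have "u \<le> v" "u \<le> t" "t \<le> v" by auto
      moreover from this have "u \<in> k" "v \<in> k" using k by auto
      moreover from this have "u \<in> ball t (r t)" "v \<in> ball t (r t)" using kb by auto
      ultimately show ?thesis using k sub t by - (rule exI[of _ u], rule exI[of _ v], auto)
    qed
    have total: "(\<Sum>(t,k)\<in>p. h (Sup k) - h (Inf k)) = h b - h a"
      using additive_tagged_division_1[OF ab p] .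
    have Pdiv: "P tagged_division_of (\<Union>(snd ` P))"
      using p split(5) tagged_partial_division_of_Union_self tagged_partial_division_subset
        tagged_division_of_def by blast
    have PD: "snd ` P division_of \<Union>(snd ` P)" using division_of_tagged_division[OF Pdiv] .
    have Pk: "\<exists>t. (t,k) \<in> p \<and> t \<in> E" if "k \<in> snd ` P" for k using that by (auto simp: P_def)
    \<comment> \<open>Passing from tagged pairs to their intervals needs a summand that vanishes on
      every box with empty interior. \<open>Sup {}\<close> and \<open>Inf {}\<close> are
      unspecified, hence the separate value at the empty set.\<close>
    define inc where "inc k = (if k = {} then 0 else h (Sup k) - h (Inf k))" for k
    have inc: "inc k = h (Sup k) - h (Inf k)" if "(t, k) \<in> p" for t k
      using tagged_division_ofD(2)[OF p that] by (auto simp: inc_def)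
    have incP: "(case z of (t, k) \<Rightarrow> h (Sup k) - h (Inf k)) = (case z of (t, k) \<Rightarrow> inc k)" if "z \<in> P" for z
      using inc[of "fst z" "snd z"] subsetD[OF split(5) that] by (simp add: split_beta)
    have "(\<Sum>(t,k)\<in>P. h (Sup k) - h (Inf k)) = (\<Sum>(t,k)\<in>P. inc k)"
      by (rule sum.cong[OF refl incP])
    also have "\<dots> = (\<Sum>k\<in>snd ` P. inc k)"
      by (rule sum.over_tagged_division_lemma[OF Pdiv]) (auto simp: inc_def)
    also have "\<dots> = (\<Sum>k\<in>snd ` P. h (Sup k) - h (Inf k))"
      using inc Pk by (intro sum.cong[OF refl]) blast
    finally have Psum: "(\<Sum>(t,k)\<in>P. h (Sup k) - h (Inf k)) = (\<Sum>k\<in>snd ` P. h (Sup k) - h (Inf k))" .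
    have PU: "\<Union>(snd ` P) \<subseteq> U"
      using fine rE by (auto simp: fine_def P_def) blast
    have len: "Sup k - Inf k = measure lborel k" if tk: "(t, k) \<in> p" for t k
    proof -
      obtain u v where "k = cbox u v" "u \<le> v" "Inf k = u" "Sup k = v" using iv[OF tk] by blast
      then show ?thesis by (metis cbox_interval content_real)
    qed
    have leb: "measure lborel k = measure lebesgue k" if tk: "(t, k) \<in> p" for t k
    proof -
      obtain u v where "k = cbox u v" using iv[OF tk] by blast
      then show ?thesis by simp
    qed
    have "(\<Sum>k\<in>snd ` P. Sup k - Inf k) = (\<Sum>k\<in>snd ` P. measure lebesgue k)"
    proof (rule sum.cong[OF refl])
      fix k assume "k \<in> snd ` P"
      then obtain t where "(t, k) \<in> p" using Pk by blast
      then show "Sup k - Inf k = measure lebesgue k" using len leb by simp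
    qed
    also have "\<dots> = measure lebesgue (\<Union>(snd ` P))"
      using content_division[OF PD] by simp
    also have "\<dots> \<le> measure lebesgue U"
      using PU Ul lmeasurable_division[OF PD] by (intro measure_mono_fmeasurable) auto
    also have "\<dots> < d" by fact
    finally have "(\<Sum>k\<in>snd ` P. norm (h (Sup k) - h (Inf k))) < e"
      using Pk tagged_division_ofD(3)[OF p] by (intro D[OF PD]) (blast, simp)
    moreover have "(\<Sum>k\<in>snd ` P. h (Sup k) - h (Inf k)) \<le> (\<Sum>k\<in>snd ` P. norm (h (Sup k) - h (Inf k)))"
      by (rule sum_mono) auto
    ultimately have Ple: "(\<Sum>(t,k)\<in>P. h (Sup k) - h (Inf k)) \<le> e" using Psum by simp
    have "(\<Sum>(t,k)\<in>Q. h (Sup k) - h (Inf k)) \<le> (\<Sum>(t,k)\<in>Q. e * measure lborel k)"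
    proof (rule sum_mono, clarify)
      fix t k assume "(t, k) \<in> Q"
      then have tk: "(t, k) \<in> p" "t \<notin> E" by (auto simp: Q_def)
      obtain u v where uv: "Inf k = u" "Sup k = v" "u \<le> t" "t \<le> v" "t \<in> {a..b}"
          "u \<in> ball t (r t) \<inter> {a..b}" "v \<in> ball t (r t) \<inter> {a..b}"
        using iv[OF tk(1)] by blast
      have "h v - h u \<le> e * (v - u)" using uv tk(2) by (intro rN[of t]) auto
      then show "h (Sup k) - h (Inf k) \<le> e * measure lborel k" using uv len[OF tk(1)] by simp
    qed
    also have "\<dots> \<le> (\<Sum>(t,k)\<in>p. e * measure lborel k)"
      using e split fin by (intro sum_mono2) auto
    also have "\<dots> = e * (\<Sum>(t,k)\<in>p. measure lborel k)" by (simp add: sum_distrib_left split_def)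
    also have "\<dots> = e * (b - a)"
      using additive_content_tagged_division[of p a b] p ab by simp
    finally have Qle: "(\<Sum>(t,k)\<in>Q. h (Sup k) - h (Inf k)) \<le> e * (b - a)" .
    have "h b - h a = (\<Sum>(t,k)\<in>P. h (Sup k) - h (Inf k)) + (\<Sum>(t,k)\<in>Q. h (Sup k) - h (Inf k))"
      using total split by (metis sum.union_disjoint)
    then show ?thesis using Ple Qle by simp
  qed
  show ?thesis
  proof (rule ccontr)
    assume "\<not> h b \<le> h a"
    then have pos: "h b - h a > 0" by simp
    \<comment> \<open>The bound of \<open>main\<close> is \<open>e * c\<close>; the next choice of
      \<open>e\<close> makes it half of the supposed positive increment.\<close>
    define c where "c = 1 + (b - a)"
    have c: "c > 0" using ab by (simp add: c_def)
    define e where "e = (h b - h a) / (2 * c)"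
    have "e > 0" using pos c by (simp add: e_def)
    moreover have "e * c = (h b - h a) / 2" using c by (simp add: e_def)
    then have "e + e * (b - a) = (h b - h a) / 2" by (simp add: c_def algebra_simps)
    ultimately show False using main[of e] pos by simp
  qed
qed

subsection \<open>Peano's existence theorem\<close>

text \<open>Euler polygons, made precompact by Arzela-Ascoli.\<close>

lemma peano_existence:
  fixes F :: "'a::euclidean_space \<Rightarrow> 'a"
  assumes cont: "continuous_on UNIV F" and bd: "\<And>x. norm (F x) \<le> B" and T: "0 \<le> T"
  obtains x where "x 0 = z"
    "\<And>t. t \<in> {0..T} \<Longrightarrow> (x has_vector_derivative F (x t)) (at t within {0..T})"
proof -
  define y where "y n = rec_nat z (\<lambda>_ w. w + (1 / real (Suc n)) *\<^sub>R F w)" for n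
  have y0: "y n 0 = z" and ySuc: "y n (Suc k) = y n k + (1 / real (Suc n)) *\<^sub>R F (y n k)" for n k
    by (auto simp: y_def)
  \<comment> \<open>\<open>s n\<close> is the step function through the Euler nodes. Writing the
    polygon \<open>X n\<close> as an integral over it yields the Lipschitz bound directly and
    prepares the limit by dominated convergence.\<close>
  define s where "s n t = y n (nat \<lfloor>t * real (Suc n)\<rfloor>)" for n t
  define X where "X n t = z + integral {0..t} (\<lambda>r. F (s n r))" for n t
  have B0: "0 \<le> B" using bd[of z] norm_ge_zero order_trans by blast
  have int: "(\<lambda>r. F (s n r)) integrable_on {a..b}" for n a b
  proof -
    \<comment> \<open>The integrand depends on \<open>r\<close> only through an integer, and any
      function on the integers is measurable.\<close>
    have "(\<lambda>r. (\<lambda>i. F (y n (nat i))) \<lfloor>r * real (Suc n)\<rfloor>) \<in> borel_measurable borel"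
      by measurable
    then have "(\<lambda>r. F (s n r)) \<in> borel_measurable (lebesgue_on {a..b})"
      unfolding s_def by (intro measurable_restrict_space1 measurable_completion) simp
    then show ?thesis
      by (rule measurable_bounded_by_integrable_imp_integrable[where g = "\<lambda>_. B"]) (auto simp: bd)
  qed
  have Xdiff: "X n v - X n u = integral {u..v} (\<lambda>r. F (s n r))" if "0 \<le> u" "u \<le> v" for n u v
    using Henstock_Kurzweil_Integration.integral_combine[OF that int] by (simp add: X_def algebra_simps)
  have Xlip': "norm (X n v - X n u) \<le> B * (v - u)" if "0 \<le> u" "u \<le> v" for n u v
    unfolding Xdiff[OF that]
    using integral_norm_bound_integral[OF int[of n u v], of "\<lambda>_. B"] that by (simp add: bd mult.commute integrable_const_ivl)
  have Xlip: "norm (X n v - X n u) \<le> B * \<bar>v - u\<bar>" if "0 \<le> u" "0 \<le> v" for n u v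
    using Xlip'[of u v n] Xlip'[of v u n] that by (cases "u \<le> v") (auto simp: norm_minus_commute)
  have Xgrid: "X n (real k / real (Suc n)) = y n k" for n k
  proof (induction k)
    case 0
    then show ?case by (simp add: X_def y0)
  next
    case (Suc k)
    let ?u = "real k / real (Suc n)" and ?v = "real (Suc k) / real (Suc n)"
    have uv: "0 \<le> ?u" "?u \<le> ?v" by (auto simp: divide_simps)
    have "s n r = y n k" if "r \<in> {?u..?v} - {?v}" for r
    proof -
      have "real k \<le> r * real (Suc n)" "r * real (Suc n) < real k + 1"
        using that by (auto simp: field_simps)
      then have "\<lfloor>r * real (Suc n)\<rfloor> = int k" by (intro floor_unique) auto
      then show ?thesis by (simp add: s_def)
    qed
    then have "integral {?u..?v} (\<lambda>r. F (s n r)) = integral {?u..?v} (\<lambda>r. F (y n k))"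
      by (intro integral_spike[of "{?v}"]) auto
    also have "\<dots> = (?v - ?u) *\<^sub>R F (y n k)" using uv by simp
    also have "?v - ?u = 1 / real (Suc n)" by (simp add: diff_divide_distrib[symmetric])
    finally show ?case using Xdiff[OF uv, of n] Suc by (simp add: ySuc algebra_simps)
  qed
  \<comment> \<open>Because of this gap, the uniform limit of the polygons is also the pointwise
    limit of the step functions at which \<open>F\<close> is evaluated.\<close>
  have Xs: "norm (X n t - s n t) \<le> B / real (Suc n)" if "0 \<le> t" for n t
  proof -
    define k where "k = nat \<lfloor>t * real (Suc n)\<rfloor>"
    let ?u = "real k / real (Suc n)"
    have k: "real k \<le> t * real (Suc n)" "t * real (Suc n) \<le> real k + 1"
      unfolding k_def using that by (auto simp: of_nat_nat)
    then have "0 \<le> ?u" "?u \<le> t" by (auto simp: divide_simps)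
    then have "norm (X n t - X n ?u) \<le> B * (t - ?u)" by (rule Xlip')
    also have "t \<le> (real k + 1) / real (Suc n)"
      using k by (simp add: pos_le_divide_eq del: of_nat_Suc)
    then have "B * (t - ?u) \<le> B * (1 / real (Suc n))"
      using B0 by (intro mult_left_mono) (auto simp: add_divide_distrib)
    finally show ?thesis unfolding Xgrid by (simp add: s_def k_def)
  qed
  obtain x k where xc: "continuous_on {0..T} x" and k: "strict_mono (k :: nat \<Rightarrow> nat)"
    and conv: "\<And>e. 0 < e \<Longrightarrow> \<exists>N. \<forall>n t. n \<ge> N \<and> t \<in> {0..T} \<longrightarrow> norm (X (k n) t - x t) < e"
  proof (rule Arzela_Ascoli[of "{0..T}" X "norm z + B * T"])
    show "norm (X n t) \<le> norm z + B * T" if "t \<in> {0..T}" for n t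
    proof -
      have "norm (X n t - X n 0) \<le> B * T"
        using Xlip'[of 0 t n] that B0 by (auto intro: order_trans mult_left_mono)
      moreover have "X n 0 = z" by (simp add: X_def)
      ultimately show ?thesis using norm_triangle_sub[of "X n t" z] by simp
    qed
    show "\<exists>d. 0 < d \<and> (\<forall>n y. y \<in> {0..T} \<and> norm (x - y) < d \<longrightarrow> norm (X n x - X n y) < e)"
      if "x \<in> {0..T}" "0 < e" for x e
    proof (intro exI[of _ "e / (B + 1)"] conjI allI impI)
      show "0 < e / (B + 1)" using that B0 by simp
      fix n y assume y: "y \<in> {0..T} \<and> norm (x - y) < e / (B + 1)"
      have "norm (X n x - X n y) \<le> B * \<bar>x - y\<bar>" using Xlip[of y x n] that y by auto
      also have "\<dots> \<le> (B + 1) * \<bar>x - y\<bar>" by (intro mult_right_mono) auto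
      also have "\<dots> < e" using y B0 by (simp add: field_simps)
      finally show "norm (X n x - X n y) < e" .
    qed
  qed auto
  have Xx: "(\<lambda>n. X (k n) t) \<longlonglongrightarrow> x t" if "t \<in> {0..T}" for t
    unfolding lim_sequentially dist_norm using conv that by meson
  have inv: "(\<lambda>n. B / real (Suc (k n))) \<longlonglongrightarrow> 0"
    using LIMSEQ_subseq_LIMSEQ[OF _ k, of "\<lambda>n. B / real (Suc n)" 0]
      LIMSEQ_Suc[OF lim_const_over_n[of B]] by (simp add: o_def)
  have sx: "(\<lambda>n. s (k n) t) \<longlonglongrightarrow> x t" if t: "t \<in> {0..T}" for t
  proof -
    have "(\<lambda>n. X (k n) t - s (k n) t) \<longlonglongrightarrow> 0"
      using t by (intro Lim_null_comparison[OF _ inv]) (auto intro!: always_eventually Xs simp del: of_nat_Suc)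
    from tendsto_diff[OF Xx[OF t] this] show ?thesis by simp
  qed
  have Fs: "(\<lambda>n. F (s (k n) t)) \<longlonglongrightarrow> F (x t)" if "t \<in> {0..T}" for t
    using sx[OF that] cont by (auto simp: continuous_on_eq_continuous_at intro: isCont_tendsto_compose)
  have eq: "x t = z + integral {0..t} (\<lambda>r. F (x r))" if t: "t \<in> {0..T}" for t
  proof -
    have "(\<lambda>n. integral {0..t} (\<lambda>r. F (s (k n) r))) \<longlonglongrightarrow> integral {0..t} (\<lambda>r. F (x r))"
      using t by (intro dominated_convergence(2)[where h = "\<lambda>_. B"] int Fs) (auto simp: bd)
    then have "(\<lambda>n. X (k n) t) \<longlonglongrightarrow> z + integral {0..t} (\<lambda>r. F (x r))"
      unfolding X_def by (intro tendsto_intros)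
    with Xx[OF t] show ?thesis by (rule LIMSEQ_unique)
  qed
  have Fx: "continuous_on {0..T} (\<lambda>r. F (x r))"
    using continuous_on_compose2[OF cont xc] by simp
  show ?thesis
  proof (rule that[of x])
    show "x 0 = z" using eq[of 0] T by simp
    fix t assume t: "t \<in> {0..T}"
    have "((\<lambda>t. z + integral {0..t} (\<lambda>r. F (x r))) has_vector_derivative 0 + F (x t)) (at t within {0..T})"
      by (intro has_vector_derivative_add has_vector_derivative_const integral_has_vector_derivative Fx t)
    then have "((\<lambda>t. z + integral {0..t} (\<lambda>r. F (x r))) has_vector_derivative F (x t)) (at t within {0..T})"
      by simp
    then show "(x has_vector_derivative F (x t)) (at t within {0..T})"
      by (rule has_vector_derivative_transform[OF t, rotated]) (rule eq)
  qed
qed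

subsection \<open>Lyapunov functions\<close>

text \<open>\<open>grad\<close> is a definite description, so existence and uniqueness are both
  required: the Riesz vector of the derivative is \<open>adjoint V' 1\<close>, and uniqueness is
  that of the Frechet derivative.\<close>

lemma has_derivative_inner_grad:
  fixes V :: "'a::euclidean_space \<Rightarrow> real"
  assumes "(V has_derivative V') (at x)"
  shows "V' h = inner (grad V x) h"
proof -
  have lin: "linear V'" using assms has_derivative_linear by blast
  have eq: "V' = (\<lambda>h. inner h (adjoint V' 1))"
    using adjoint_works[OF lin, of _ 1] by auto
  then have G: "GDERIV V x :> adjoint V' 1" using assms by (simp add: gderiv_def)
  moreover have "D = adjoint V' 1" if "GDERIV V x :> D" for D
  proof -
    have "V' = (\<lambda>h. inner h D)"
      using has_derivative_unique[OF assms] that by (simp add: gderiv_def)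
    then have "inner h D = inner h (adjoint V' 1)" for h using fun_cong[OF eq, of h] by metis
    then show ?thesis by (metis vector_eq_ldot)
  qed
  ultimately have "grad V x = adjoint V' 1" unfolding grad_def by (rule the_equality)
  then show ?thesis using fun_cong[OF eq, of h] by (simp add: inner_commute)
qed

lemma twice_cont_diff_continuous_on:
  assumes "twice_cont_diff F"
  shows "continuous_on UNIV F"
  using assms unfolding twice_cont_diff_def
  by (meson continuous_at_imp_continuous_on has_derivative_continuous)

lemma twice_cont_diff_grad:
  fixes V :: "'a::euclidean_space \<Rightarrow> real"
  assumes "twice_cont_diff V"
  shows "(V has_derivative inner (grad V x)) (at x)" and "continuous_on UNIV (grad V)"
proof -
  obtain V' :: "'a \<Rightarrow> 'a \<Rightarrow>\<^sub>L real" and V'' where V': "\<And>x. (V has_derivative blinfun_apply (V' x)) (at x)"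
    and V'': "\<And>x. (V' has_derivative blinfun_apply (V'' x)) (at x)"
    using assms unfolding twice_cont_diff_def by blast
  have eq: "blinfun_apply (V' x) = inner (grad V x)" for x
    using has_derivative_inner_grad[OF V'] by blast
  show "(V has_derivative inner (grad V x)) (at x)" using V'[of x] eq by simp
  have "continuous_on UNIV V'"
    using V'' by (meson continuous_at_imp_continuous_on has_derivative_continuous)
  then have "continuous_on UNIV (\<lambda>x. \<Sum>b\<in>Basis. blinfun_apply (V' x) b *\<^sub>R b)"
    by (intro continuous_intros)
  moreover have "(\<Sum>b\<in>Basis. blinfun_apply (V' x) b *\<^sub>R b) = grad V x" for x
    by (simp add: eq euclidean_representation)
  ultimately show "continuous_on UNIV (grad V)" by simp
qed

text \<open>The gradient is bounded on the compact ball, and the ball is convex, so the mean value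
  inequality applies. This bound is what carries absolute continuity from \<open>x\<close> to
  \<open>V\<close> along \<open>x\<close>.\<close>

lemma twice_cont_diff_lipschitz_on_cball:
  fixes V :: "'a::euclidean_space \<Rightarrow> real"
  assumes "twice_cont_diff V"
  obtains L where "L-lipschitz_on (cball 0 R) V"
proof -
  have "compact (grad V ` cball 0 R)"
    using twice_cont_diff_grad(2)[OF assms]
    by (intro compact_continuous_image) (auto intro: continuous_on_subset)
  then have "bounded (grad V ` cball 0 R)" by (rule compact_imp_bounded)
  then obtain B where "B > 0" "\<forall>y\<in>grad V ` cball 0 R. norm y \<le> B" unfolding bounded_pos by blast
  then have B: "B > 0" "\<And>x. x \<in> cball 0 R \<Longrightarrow> norm (grad V x) \<le> B" by auto
  have "norm (V x - V y) \<le> B * norm (x - y)" if "x \<in> cball 0 R" "y \<in> cball 0 R" for x y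
  proof (rule differentiable_bound[where f = V and B = B and S = "cball 0 R" and f' = "\<lambda>x. inner (grad V x)"])
    show "(V has_derivative inner (grad V x)) (at x within cball 0 R)" for x
      by (rule has_derivative_at_withinI[OF twice_cont_diff_grad(1)[OF assms]])
    show "onorm (inner (grad V x)) \<le> B" if "x \<in> cball 0 R" for x
    proof (rule onorm_le)
      fix h
      have "norm (inner (grad V x) h) \<le> norm (grad V x) * norm h"
        using Cauchy_Schwarz_ineq2 by simp
      also have "\<dots> \<le> B * norm h" using B(2)[OF that] by (intro mult_right_mono) auto
      finally show "norm (inner (grad V x) h) \<le> B * norm h" .
    qed
  qed (use that in auto)
  then have "B-lipschitz_on (cball 0 R) V"
    using B(1) by (intro lipschitz_onI) (auto simp: dist_norm)
  then show ?thesis by (rule that)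
qed

text \<open>The weight \<open>exp (- c * t)\<close> turns the differential inequality into a
  nonpositive derivative of \<open>h\<close> off \<open>E\<close>. Once \<open>h\<close> is known to
  be absolutely continuous, it is nonincreasing.\<close>

lemma lyapunov_decay:
  fixes V :: "'a::euclidean_space \<Rightarrow> real"
  assumes V: "twice_cont_diff V" and ac: "abs_continuous_on {a..b} x" and ab: "a \<le> b"
    and E: "negligible E"
    and der: "\<And>t. t \<in> {a..b} - E \<Longrightarrow> (x has_vector_derivative F (x t)) (at t within {a..b})"
    and Lie: "\<And>y. Lie_deriv F V y \<le> c * V y"
  shows "V (x b) \<le> exp (c * (b - a)) * V (x a)"
proof -
  define h where "h t = exp (- c * t) * V (x t)" for t
  have xc: "continuous_on {a..b} x" by (rule abs_continuous_on_imp_continuous_on[OF ac])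
  then have "bounded (x ` {a..b})" by (intro compact_imp_bounded compact_continuous_image) auto
  then obtain R where "\<forall>y\<in>x ` {a..b}. norm y \<le> R" unfolding bounded_iff by blast
  then have R: "\<And>t. t \<in> {a..b} \<Longrightarrow> x t \<in> cball 0 R" by simp
  obtain L where L: "L-lipschitz_on (cball 0 R) V"
    using twice_cont_diff_lipschitz_on_cball[OF V] by blast
  have "continuous_on {a..b} (\<lambda>t. V (x t))"
    using continuous_on_compose2[OF twice_cont_diff_continuous_on[OF V] xc] by simp
  then have "bounded ((\<lambda>t. V (x t)) ` {a..b})"
    by (intro compact_imp_bounded compact_continuous_image) auto
  then obtain C where "C > 0" "\<forall>y\<in>(\<lambda>t. V (x t)) ` {a..b}. norm y \<le> C" unfolding bounded_pos by blast
  then have C: "\<And>t. t \<in> {a..b} \<Longrightarrow> \<bar>V (x t)\<bar> \<le> C" "C > 0" by auto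
  have "bounded ((\<lambda>t. exp (- c * t)) ` {a..b})"
    by (intro compact_imp_bounded compact_continuous_image continuous_intros) auto
  then obtain D where "D > 0" "\<forall>y\<in>(\<lambda>t. exp (- c * t)) ` {a..b}. norm y \<le> D" unfolding bounded_pos by blast
  then have D: "\<And>t. t \<in> {a..b} \<Longrightarrow> exp (- c * t) \<le> D" "D > 0" by auto
  have expL: "\<bar>exp (- c * v) - exp (- c * u)\<bar> \<le> (\<bar>c\<bar> * D) * (v - u)"
    if "u \<in> {a..b}" "v \<in> {a..b}" "u \<le> v" for u v
  proof -
    have "norm (exp (- c * v) - exp (- c * u)) \<le> (\<bar>c\<bar> * D) * norm (v - u)"
    proof (rule field_differentiable_bound[where f = "\<lambda>t. exp (- c * t)" and B = "\<bar>c\<bar> * D" and S = "{a..b}" and f' = "\<lambda>t. - c * exp (- c * t)"])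
      show "((\<lambda>t. exp (- c * t)) has_field_derivative - c * exp (- c * z)) (at z within {a..b})" for z
        by (auto intro!: derivative_eq_intros)
      show "norm (- c * exp (- c * z)) \<le> \<bar>c\<bar> * D" if "z \<in> {a..b}" for z
        using D(1)[OF that] by (auto simp: abs_mult intro: mult_left_mono)
    qed (use that in auto)
    then show ?thesis using that by simp
  qed
  have L0: "0 \<le> L" using L lipschitz_on_nonneg by auto
  \<comment> \<open>An increment of the product \<open>h\<close> splits into a change of
    \<open>V\<close> along \<open>x\<close>, with constant \<open>D * L\<close>, and a change of the
    exponential, with constant \<open>C * (\<bar>c\<bar> * D)\<close>.\<close>
  define K where "K = D * L + C * (\<bar>c\<bar> * D)"
  have K: "D * L \<le> K" "C * (\<bar>c\<bar> * D) \<le> K" "0 \<le> K"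
    using D(2) C(2) L0 by (auto simp: K_def)
  have "abs_continuous_on {a..b} h"
  proof (rule abs_continuous_on_dominated[OF ac K(3)])
    fix u v assume uv: "u \<in> {a..b}" "v \<in> {a..b}" "u \<le> v"
    have VL: "\<bar>V (x v) - V (x u)\<bar> \<le> L * norm (x v - x u)"
      using lipschitz_onD[OF L R R, OF uv(2,1)] by (simp add: dist_norm)
    have "h v - h u = exp (- c * v) * (V (x v) - V (x u)) + V (x u) * (exp (- c * v) - exp (- c * u))"
      by (simp add: h_def algebra_simps)
    also have "\<bar>\<dots>\<bar> \<le> exp (- c * v) * \<bar>V (x v) - V (x u)\<bar> + \<bar>V (x u)\<bar> * \<bar>exp (- c * v) - exp (- c * u)\<bar>"
      by (rule order_trans[OF abs_triangle_ineq]) (simp add: abs_mult)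
    also have "\<dots> \<le> D * (L * norm (x v - x u)) + C * ((\<bar>c\<bar> * D) * (v - u))"
      using uv D C VL expL[OF uv] by (intro add_mono mult_mono) auto
    also have "\<dots> \<le> K * norm (x v - x u) + K * (v - u)"
      using mult_right_mono[OF K(1), of "norm (x v - x u)"] mult_right_mono[OF K(2), of "v - u"] uv
      by (simp add: mult.assoc)
    finally show "norm (h v - h u) \<le> K * (norm (x v - x u) + (v - u))"
      by (simp add: distrib_left)
  qed
  moreover have "\<exists>d\<le>0. (h has_vector_derivative d) (at t within {a..b})" if t: "t \<in> {a..b} - E" for t
  proof (intro exI conjI)
    have "((V \<circ> x) has_vector_derivative inner (grad V (x t)) (F (x t))) (at t within {a..b})"
      by (rule vector_derivative_diff_chain_within[OF der[OF t]])
        (rule has_derivative_at_withinI[OF twice_cont_diff_grad(1)[OF V]])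
    then have Vx: "((\<lambda>t. V (x t)) has_real_derivative Lie_deriv F V (x t)) (at t within {a..b})"
      by (simp add: o_def Lie_deriv_def has_real_derivative_iff_has_vector_derivative)
    have "((\<lambda>t. exp (- c * t)) has_real_derivative - c * exp (- c * t)) (at t within {a..b})"
      by (auto intro!: derivative_eq_intros)
    from DERIV_mult[OF this Vx]
    have "(h has_real_derivative exp (- c * t) * (Lie_deriv F V (x t) - c * V (x t))) (at t within {a..b})"
      unfolding h_def by (simp add: algebra_simps)
    then show "(h has_vector_derivative exp (- c * t) * (Lie_deriv F V (x t) - c * V (x t))) (at t within {a..b})"
      by (simp add: has_real_derivative_iff_has_vector_derivative)
    show "exp (- c * t) * (Lie_deriv F V (x t) - c * V (x t)) \<le> 0"
      using Lie[of "x t"] by (intro mult_nonneg_nonpos) auto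
  qed
  ultimately have "h b \<le> h a" by (intro abs_continuous_on_nonincreasing[OF _ ab E]) auto
  then have "exp (c * b) * h b \<le> exp (c * b) * h a" by (intro mult_left_mono) auto
  moreover have "exp (c * b) * h b = V (x b)" by (simp add: h_def mult.assoc[symmetric] exp_add[symmetric])
  moreover have "exp (c * b) * h a = exp (c * (b - a)) * V (x a)"
    by (simp add: h_def mult.assoc[symmetric] exp_add[symmetric] right_diff_distrib)
  ultimately show ?thesis by simp
qed

subsection \<open>Sontag's formula\<close>

text \<open>Each disjunct is an open region on which a single quotient with nonzero denominator
  represents \<open>phi\<close>. By (C3), the pair \<open>(W_bar, W_tilde)\<close> lies in their
  union at every nonzero state.\<close>

lemma isCont_phi:
  assumes "a < 0 \<or> b \<noteq> 0"
  shows "isCont (\<lambda>p. phi (fst p) (snd p)) (a, b)"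
proof (cases "b = 0")
  case False
  have "isCont (\<lambda>p::real \<times> real. (fst p + sqrt ((fst p)\<^sup>2 + (snd p)\<^sup>2)) / snd p) (a, b)"
    using False by (intro continuous_intros) auto
  moreover have "open {p::real \<times> real. snd p \<noteq> 0}"
    by (intro open_Collect_neq continuous_intros)
  then have "\<forall>\<^sub>F p in nhds (a, b). p \<in> {p::real \<times> real. snd p \<noteq> 0}"
    using False by (intro eventually_nhds_in_open) auto
  then have "\<forall>\<^sub>F p in nhds (a, b). phi (fst p) (snd p) = (fst p + sqrt ((fst p)\<^sup>2 + (snd p)\<^sup>2)) / snd p"
    by (rule eventually_mono) (simp add: phi_def)
  ultimately show ?thesis
    by (simp add: isCont_cong)
next
  case True
  \<comment> \<open>Rationalising the numerator removes the singularity at \<open>b = 0\<close>.\<close>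
  then have a: "a < 0" using assms by simp
  have rat: "phi s t = t / (sqrt (s\<^sup>2 + t\<^sup>2) - s)" if "s < 0" for s t
  proof (cases "t = 0")
    case False
    have "sqrt (s\<^sup>2 + t\<^sup>2) - s > 0" using that by (smt (verit) real_sqrt_ge_zero zero_le_power2)
    moreover have "(s + sqrt (s\<^sup>2 + t\<^sup>2)) * (sqrt (s\<^sup>2 + t\<^sup>2) - s) = t * t"
      by (simp add: algebra_simps power2_eq_square[symmetric])
    ultimately show ?thesis using False by (simp add: phi_def frac_eq_eq)
  qed (simp add: phi_def)
  have "isCont (\<lambda>p::real \<times> real. snd p / (sqrt ((fst p)\<^sup>2 + (snd p)\<^sup>2) - fst p)) (a, b)"
    using a True by (intro continuous_intros) auto
  moreover have "open {p::real \<times> real. fst p < 0}"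
    by (intro open_Collect_less continuous_intros)
  then have "\<forall>\<^sub>F p in nhds (a, b). p \<in> {p::real \<times> real. fst p < 0}"
    using a by (intro eventually_nhds_in_open) auto
  then have "\<forall>\<^sub>F p in nhds (a, b). phi (fst p) (snd p) = snd p / (sqrt ((fst p)\<^sup>2 + (snd p)\<^sup>2) - fst p)"
    by (rule eventually_mono) (simp add: rat)
  ultimately show ?thesis
    by (simp add: isCont_cong)
qed

lemma phi_nonneg: "0 \<le> b \<Longrightarrow> 0 \<le> phi a b"
  by (auto simp: phi_def intro!: divide_nonneg_nonneg) (smt (verit) real_sqrt_abs real_sqrt_le_mono zero_le_power2)

text \<open>For \<open>b = W_tilde\<close> the left side is the Euclidean norm of the feedback. The
  natural bound is \<open>2 + sqrt b\<close>; it is weakened to \<open>3 + b\<close>, which involves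
  no root.\<close>

lemma sqrt_mult_phi_le:
  assumes b: "0 \<le> b" and a: "a \<le> sqrt b"
  shows "sqrt b * phi a b \<le> 3 + b"
proof (cases "b = 0")
  case False
  define r where "r = sqrt b"
  have r: "r > 0" "b = r * r" using b False by (auto simp: r_def)
  have "sqrt (a\<^sup>2 + b\<^sup>2) \<le> \<bar>a\<bar> + b" using sqrt_sum_squares_le_sum_abs[of a b] b by simp
  then have "a + sqrt (a\<^sup>2 + b\<^sup>2) \<le> 2 * r + b" using a r(1) unfolding r_def by linarith
  then have "r * phi a b \<le> r * ((2 * r + b) / b)"
    using r(1) b False by (simp add: phi_def) (intro mult_left_mono divide_right_mono, auto)
  also have "\<dots> = 2 + r" using r(1) unfolding r(2) by (simp add: field_simps)
  also have "\<dots> \<le> 3 + b" using zero_le_square[of "r - 1"] r(1) unfolding r(2) by (simp add: algebra_simps)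
  finally show ?thesis by (simp add: r_def)
qed (simp add: phi_def)

lemma Lie_deriv_closed_loop:
  "Lie_deriv (closed_loop f g k i) V x =
    Lie_deriv (f i) V x + (\<Sum>j\<in>UNIV. k i x $ j * Lie_deriv (g i j) V x)"
  by (simp add: Lie_deriv_def closed_loop_def inner_add_right inner_sum_right)

lemma W_tilde_nonneg: "0 \<le> W_tilde g V i x"
  by (auto simp: W_tilde_def intro: sum_nonneg)

lemma W_tilde_eq_0_iff: "W_tilde g V i x = 0 \<longleftrightarrow> (\<forall>j. Lie_deriv (g i j) (V i) x = 0)"
  by (auto simp: W_tilde_def sum_nonneg_eq_0_iff)

text \<open>The feedback contributes \<open>- b * phi a b\<close>. For \<open>b\<close> nonzero this
  is \<open>- a - sqrt (a\<^sup>2 + b\<^sup>2)\<close>, which cancels \<open>a\<close>; for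
  \<open>b = 0\<close> the control has no effect and the assumption takes over.\<close>

lemma Lie_deriv_feedback_le:
  assumes "W_tilde g V i x = 0 \<Longrightarrow> W_bar f V lam i x \<le> 0"
  shows "Lie_deriv (closed_loop f g (feedback f g V lam) i) (V i) x \<le> - lam i * V i x"
proof -
  let ?a = "W_bar f V lam i x" and ?b = "W_tilde g V i x"
  have "(\<Sum>j\<in>UNIV. feedback f g V lam i x $ j * Lie_deriv (g i j) (V i) x) = - (?b * phi ?a ?b)"
    by (simp add: feedback_def W_tilde_def sum_distrib_right sum_negf[symmetric] power2_eq_square mult_ac)
  then have "Lie_deriv (closed_loop f g (feedback f g V lam) i) (V i) x = ?a - lam i * V i x - ?b * phi ?a ?b"
    by (simp add: Lie_deriv_closed_loop W_bar_def)
  moreover have "?a \<le> ?b * phi ?a ?b"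
    using assms by (cases "?b = 0") (auto simp: phi_def)
  ultimately show ?thesis by simp
qed

lemma continuous_on_Lie_deriv:
  fixes F :: "'a::euclidean_space \<Rightarrow> 'a"
  assumes "twice_cont_diff V" "continuous_on UNIV F"
  shows "continuous_on UNIV (Lie_deriv F V)"
  unfolding Lie_deriv_def[abs_def]
  by (intro continuous_on_inner twice_cont_diff_grad(2)[OF assms(1)] assms(2))

text \<open>Away from the origin \<open>phi\<close> is continuous at the relevant arguments. Near
  the origin the controls of norm below \<open>1\<close> bound the feedback, though it need not
  converge; each term tends to \<open>0\<close> because \<open>g i j\<close> does.\<close>

lemma continuous_on_closed_loop_feedback:
  fixes f :: "nat \<Rightarrow> real^'n \<Rightarrow> real^'n" and g :: "nat \<Rightarrow> 'm::finite \<Rightarrow> real^'n \<Rightarrow> real^'n"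
  assumes f: "continuous_on UNIV (f i)" "f i 0 = 0"
    and g: "\<And>j. continuous_on UNIV (g i j)" "\<And>j. g i j 0 = 0"
    and V: "twice_cont_diff (V i)"
    and neg: "\<And>x. x \<noteq> 0 \<Longrightarrow> W_tilde g V i x = 0 \<Longrightarrow> W_bar f V lam i x < 0"
    and small: "\<delta> > 0" "\<And>x. x \<noteq> 0 \<Longrightarrow> norm x < \<delta> \<Longrightarrow>
      \<exists>u::real^'m. norm u < 1 \<and> W_bar f V lam i x + (\<Sum>j\<in>UNIV. u $ j * Lie_deriv (g i j) (V i) x) \<le> 0"
  shows "continuous_on UNIV (closed_loop f g (feedback f g V lam) i)"
  unfolding continuous_on_eq_continuous_at[OF open_UNIV]
proof (intro ballI)
  fix x :: "real^'n"
  have Lf: "isCont (Lie_deriv (f i) (V i)) y" and Lg: "isCont (Lie_deriv (g i j) (V i)) y" 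
    and cf: "isCont (f i) y" and cg: "isCont (g i j) y" and cV: "isCont (V i) y" for y j
    using continuous_on_Lie_deriv[OF V f(1)] continuous_on_Lie_deriv[OF V g(1)] f(1) g(1)
      twice_cont_diff_continuous_on[OF V]
    by (simp_all add: continuous_on_eq_continuous_at)
  have cWb: "isCont (W_bar f V lam i) y" for y
    unfolding W_bar_def[abs_def] by (intro continuous_add continuous_mult continuous_const Lf cV)
  have cWt: "isCont (W_tilde g V i) y" for y
    unfolding W_tilde_def[abs_def] by (intro continuous_sum continuous_power Lg)
  show "isCont (closed_loop f g (feedback f g V lam) i) x"
  proof (cases "x = 0")
    case False
    have "isCont (\<lambda>p. phi (fst p) (snd p)) (W_bar f V lam i x, W_tilde g V i x)"
      using neg[OF False] by (intro isCont_phi) auto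
    from isCont_o2[OF continuous_Pair[OF cWb cWt] this]
    have cphi: "isCont (\<lambda>y. phi (W_bar f V lam i y) (W_tilde g V i y)) x" by simp
    have "isCont (\<lambda>y. f i y + (\<Sum>j\<in>UNIV. (- Lie_deriv (g i j) (V i) y * phi (W_bar f V lam i y) (W_tilde g V i y)) *\<^sub>R g i j y)) x"
      by (intro continuous_add continuous_sum continuous_scaleR continuous_mult continuous_minus cphi cf cg Lg)
    then show ?thesis by (simp add: closed_loop_def[abs_def] feedback_def)
  next
    case True
    have ev: "\<forall>\<^sub>F y in at 0. norm (feedback f g V lam i y $ j *\<^sub>R g i j y) \<le> (3 + W_tilde g V i y) * norm (g i j y)" for j
      unfolding eventually_at
    proof (intro exI[of _ \<delta>] conjI ballI impI small(1))
      fix y :: "real^'n" assume y: "y \<noteq> 0 \<and> dist y 0 < \<delta>"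
      let ?a = "W_bar f V lam i y" and ?b = "W_tilde g V i y"
      define w :: "real^'m" where "w = (\<chi> j. Lie_deriv (g i j) (V i) y)"
      have normw: "norm w = sqrt ?b"
        by (simp add: w_def norm_vec_def L2_set_def W_tilde_def)
      obtain u :: "real^'m" where u: "norm u < 1" "?a + inner u w \<le> 0"
        using small(2)[of y] y by (auto simp: inner_vec_def w_def)
      \<comment> \<open>The control gives \<open>?a \<le> - inner u w\<close>. Cauchy-Schwarz and
        \<open>norm u < 1\<close> turn this into the hypothesis \<open>a \<le> sqrt b\<close> of the
        estimate for \<open>phi\<close>.\<close>
      have "?a \<le> norm u * norm w" using u(2) Cauchy_Schwarz_ineq2[of u w] by linarith
      also have "\<dots> \<le> sqrt ?b" using u(1) normw W_tilde_nonneg[of g V i y] by (simp add: mult_left_le_one_le)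
      finally have "sqrt ?b * phi ?a ?b \<le> 3 + ?b" by (rule sqrt_mult_phi_le[OF W_tilde_nonneg])
      moreover have "\<bar>feedback f g V lam i y $ j\<bar> \<le> sqrt ?b * phi ?a ?b"
        using component_le_norm_cart[of w j] phi_nonneg[OF W_tilde_nonneg, of ?a g V i y] normw
        by (auto simp: feedback_def abs_mult w_def intro!: mult_right_mono)
      ultimately show "norm (feedback f g V lam i y $ j *\<^sub>R g i j y) \<le> (3 + ?b) * norm (g i j y)"
        by (auto intro!: mult_right_mono)
    qed
    have "((\<lambda>y. (3 + W_tilde g V i y) * norm (g i j y)) \<longlongrightarrow> (3 + W_tilde g V i 0) * norm (g i j 0)) (at 0)" for j
      using cWt[of 0] cg[of 0 j] unfolding isCont_def by (intro tendsto_intros)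
    then have "((\<lambda>y. feedback f g V lam i y $ j *\<^sub>R g i j y) \<longlongrightarrow> 0) (at 0)" for j
      using Lim_null_comparison[OF ev[of j]] by (simp add: g(2))
    then have "((\<lambda>y. f i y + (\<Sum>j\<in>UNIV. feedback f g V lam i y $ j *\<^sub>R g i j y)) \<longlongrightarrow> f i 0 + (\<Sum>j\<in>(UNIV :: 'm set). 0)) (at 0)"
      using cf[of 0] unfolding isCont_def by (intro tendsto_add tendsto_sum)
    then show ?thesis
      using True by (simp add: isCont_def closed_loop_def[abs_def] f(2) g(2))
  qed
qed

subsection \<open>Switching signals of class EH\<close>

text \<open>Multiplying the density by \<open>exp (- c * x)\<close> gives \<open>l / (l + c)\<close>
  times the exponential density with parameter \<open>c + l\<close>. The condition on
  \<open>c + l\<close> admits negative \<open>c\<close>, hence modes in which \<open>V\<close> may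
  grow.\<close>

lemma (in prob_space) nn_integral_exp_exponential:
  assumes D: "distributed M lborel S (exponential_density l)" and l: "0 < l" and c: "0 < c + l"
  shows "(\<integral>\<^sup>+\<omega>. ennreal (exp (- c * S \<omega>)) \<partial>M) = ennreal (1 / (1 + c / l))"
proof -
  have "(\<integral>\<^sup>+\<omega>. ennreal (exp (- c * S \<omega>)) \<partial>M)
      = (\<integral>\<^sup>+x. ennreal (exponential_density l x) * ennreal (exp (- c * x)) \<partial>lborel)"
    using distributed_nn_integral[OF D, of "\<lambda>x. ennreal (exp (- c * x))"] by simp
  also have "\<dots> = (\<integral>\<^sup>+x. ennreal (1 / (1 + c / l)) * ennreal (exponential_density (c + l) x) \<partial>lborel)"
  proof (intro nn_integral_cong)
    fix x
    have "exponential_density l x * exp (- c * x) = 1 / (1 + c / l) * exponential_density (c + l) x"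
      using l c by (auto simp: exponential_density_def exp_add[symmetric] mult.assoc field_simps)
    then show "ennreal (exponential_density l x) * ennreal (exp (- c * x))
        = ennreal (1 / (1 + c / l)) * ennreal (exponential_density (c + l) x)"
      using l c by (simp add: ennreal_mult[symmetric] exponential_density_nonneg field_simps)
  qed
  also have "\<dots> = ennreal (1 / (1 + c / l)) * (\<integral>\<^sup>+x. ennreal (exponential_density (c + l) x) \<partial>lborel)"
    by (rule nn_integral_cmult) simp
  also have "(\<integral>\<^sup>+x. ennreal (exponential_density (c + l) x) \<partial>lborel) = 1"
    using prob_space.emeasure_space_1[OF prob_space_exponential_density[OF c]]
    by (simp add: emeasure_density)
  finally show ?thesis by simp
qed

text \<open>Reconciles two indexings: holding times start at \<open>1\<close>, modes at
  \<open>0\<close>, and mode \<open>k\<close> is held for the time \<open>S (Suc k)\<close>.\<close>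

lemma (in prob_space) nn_integral_prod_Suc:
  fixes a :: "nat \<Rightarrow> 'b::topological_space \<Rightarrow> ennreal"
  assumes ind: "indep_vars (\<lambda>_. borel) S {1..}" and a: "\<And>k. a k \<in> borel_measurable borel"
  shows "(\<integral>\<^sup>+\<omega>. (\<Prod>k<n. a k (S (Suc k) \<omega>)) \<partial>M) = (\<Prod>k<n. \<integral>\<^sup>+\<omega>. a k (S (Suc k) \<omega>) \<partial>M)"
proof -
  have "indep_vars (\<lambda>_. borel) (\<lambda>i \<omega>. a (i - 1) (S i \<omega>)) {1..n}"
    by (rule indep_vars_compose2[OF indep_vars_subset[OF ind]]) (auto simp: a)
  then have "(\<integral>\<^sup>+\<omega>. (\<Prod>i\<in>{1..n}. a (i - 1) (S i \<omega>)) \<partial>M) = (\<Prod>i\<in>{1..n}. \<integral>\<^sup>+\<omega>. a (i - 1) (S i \<omega>) \<partial>M)"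
    by (intro indep_vars_nn_integral) auto
  then show ?thesis by (simp add: prod.atLeast1_atMost_eq)
qed

text \<open>Independence passes from sigma-algebras to variables measurable with respect to them.
  Both variables are \<open>ennreal\<close>-valued, so the product formula for
  \<open>indep_vars\<close> applies.\<close>

lemma (in prob_space) nn_integral_indicator_mult_indep:
  fixes G :: "'a \<Rightarrow> ennreal"
  assumes ind: "indep_set (sets MA) (sets MB)"
    and sp: "space MA = space M" "space MB = space M"
    and G: "G \<in> borel_measurable MA" and A: "A \<in> sets MB"
  shows "(\<integral>\<^sup>+\<omega>. indicator A \<omega> * G \<omega> \<partial>M) = emeasure M A * (\<integral>\<^sup>+\<omega>. G \<omega> \<partial>M)"
proof -
  have sub: "sets MA \<subseteq> events" "sets MB \<subseteq> events"
    using ind unfolding indep_set_def indep_sets_def by (auto simp: UNIV_bool)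
  have GM: "random_variable borel G"
    using sub(1) sp by (intro measurable_from_subalg[OF _ G]) (simp add: subalgebra_def)
  have IB: "(indicator A :: 'a \<Rightarrow> ennreal) \<in> borel_measurable MB"
    using A by (rule borel_measurable_indicator)
  have IM: "random_variable borel (indicator A :: 'a \<Rightarrow> ennreal)"
    using A sub(2) by (intro borel_measurable_indicator) auto
  have "indep_var borel G borel (indicator A :: 'a \<Rightarrow> ennreal)"
    unfolding indep_var_eq
  proof (intro conjI GM IM)
    have 1: "sigma_sets (space M) {G -` B \<inter> space M |B. B \<in> sets borel} \<subseteq> sets MA"
      using measurable_sets[OF G] unfolding sp(1)[symmetric] by (intro sets.sigma_sets_subset) auto
    have 2: "sigma_sets (space M) {(indicator A :: 'a \<Rightarrow> ennreal) -` B \<inter> space M |B. B \<in> sets borel} \<subseteq> sets MB"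
      using measurable_sets[OF IB] unfolding sp(2)[symmetric] by (intro sets.sigma_sets_subset) auto
    show "indep_set (sigma_sets (space M) {G -` B \<inter> space M |B. B \<in> sets borel})
        (sigma_sets (space M) {(indicator A :: 'a \<Rightarrow> ennreal) -` B \<inter> space M |B. B \<in> sets borel})"
      using ind unfolding indep_set_def
      by (rule indep_sets_mono_sets) (use 1 2 in \<open>auto split: bool.split\<close>)
  qed
  moreover have "case_bool borel borel = (\<lambda>_. borel :: ennreal measure)"
    by (auto split: bool.split)
  ultimately have "indep_vars (\<lambda>_. borel) (case_bool G (indicator A)) (UNIV :: bool set)"
    unfolding indep_var_def by simp
  from indep_vars_nn_integral[OF _ this]
  have "(\<integral>\<^sup>+\<omega>. G \<omega> * indicator A \<omega> \<partial>M) = (\<integral>\<^sup>+\<omega>. G \<omega> \<partial>M) * (\<integral>\<^sup>+\<omega>. indicator A \<omega> \<partial>M)"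
    by (simp add: UNIV_bool mult.commute)
  then show ?thesis using A sub by (simp add: nn_integral_indicator subset_iff mult.commute)
qed

text \<open>The series of the \<open>X n\<close> has finite expectation, so it converges almost
  surely and its terms tend to \<open>0\<close>.\<close>

lemma (in prob_space) AE_tendsto_0_of_summable_expectation:
  fixes X :: "nat \<Rightarrow> 'a \<Rightarrow> real"
  assumes X: "\<And>n. random_variable borel (X n)" "\<And>n \<omega>. 0 \<le> X n \<omega>"
    and e: "\<And>n. (\<integral>\<^sup>+\<omega>. ennreal (X n \<omega>) \<partial>M) \<le> ennreal (e n)" "\<And>n. 0 \<le> e n" "summable e"
  shows "AE \<omega> in M. (\<lambda>n. X n \<omega>) \<longlonglongrightarrow> 0"
proof -
  have "(\<integral>\<^sup>+\<omega>. (\<Sum>n. ennreal (X n \<omega>)) \<partial>M) = (\<Sum>n. \<integral>\<^sup>+\<omega>. ennreal (X n \<omega>) \<partial>M)"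
    using X by (intro nn_integral_suminf) auto
  also have "\<dots> \<le> (\<Sum>n. ennreal (e n))" using e by (intro suminf_le) auto
  also have "\<dots> = ennreal (\<Sum>n. e n)" using e by (intro suminf_ennreal2) auto
  also have "\<dots> < \<infinity>" by simp
  finally have "AE \<omega> in M. (\<Sum>n. ennreal (X n \<omega>)) \<noteq> \<infinity>"
    using X by (intro nn_integral_noteq_infinite) auto
  then show ?thesis
  proof eventually_elim
    case (elim \<omega>)
    then have "summable (\<lambda>n. X n \<omega>)" using X by (intro summable_suminf_not_top) auto
    then show ?case by (rule summable_LIMSEQ_zero)
  qed
qed

text \<open>The sigma-algebra is a parameter because the event is needed in
  \<open>mode_history\<close> for conditioning, in \<open>mode_algebra\<close> for independence, and
  in \<open>M\<close>.\<close>

lemma mode_path_sets: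
  assumes "\<And>k. k < n \<Longrightarrow> mode \<sigma> \<tau> k \<in> measurable N (count_space UNIV)"
    and "space N = space M"
  shows "{\<omega>\<in>space M. \<forall>k\<in>{..<n}. mode \<sigma> \<tau> k \<omega> = p k} \<in> sets N"
proof -
  have "{\<omega>\<in>space N. \<forall>k\<in>{..<n}. mode \<sigma> \<tau> k \<omega> = p k} \<in> sets N"
  proof (rule sets.sets_Collect_finite_All)
    fix k assume "k \<in> {..<n}"
    then have "mode \<sigma> \<tau> k -` {p k} \<inter> space N \<in> sets N"
      using assms(1) by (auto intro: measurable_sets)
    then show "{\<omega>\<in>space N. mode \<sigma> \<tau> k \<omega> = p k} \<in> sets N" by (simp add: vimage_def Int_def conj_commute)
  qed auto
  then show ?thesis unfolding assms(2) .
qed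

section \<open>Expectations along mode paths\<close>

context prob_space
begin

context
  fixes N :: nat and \<sigma> :: "real \<Rightarrow> 'a \<Rightarrow> nat" and \<sigma>0 :: nat and \<tau> rate q
  assumes signal: "switching_signal M N \<sigma> \<sigma>0 \<tau>"
    and EH: "class_EH M N \<sigma> \<tau> rate q"
begin

definition "holding_algebra = vimage_algebra (space M) (\<lambda>\<omega>. \<lambda>i\<in>{1..}. holding_time \<tau> i \<omega>) (PiM {1..} (\<lambda>_. borel))"
definition "mode_algebra = vimage_algebra (space M) (\<lambda>\<omega> i. mode \<sigma> \<tau> i \<omega>) (PiM UNIV (\<lambda>_. count_space UNIV))"

lemma indep_algebras: "indep_set (sets holding_algebra) (sets mode_algebra)"
  using EH unfolding class_EH_def holding_algebra_def mode_algebra_def by blast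

lemma space_algebras: "space holding_algebra = space M" "space mode_algebra = space M"
  by (simp_all add: holding_algebra_def mode_algebra_def)

lemma holding_time_measurable: "i \<ge> 1 \<Longrightarrow> holding_time \<tau> i \<in> borel_measurable holding_algebra"
proof -
  assume i: "i \<ge> 1"
  have "(\<lambda>\<omega>. \<lambda>i\<in>{1..}. holding_time \<tau> i \<omega>) \<in> measurable holding_algebra (PiM {1..} (\<lambda>_. borel))"
    unfolding holding_algebra_def by (intro measurable_vimage_algebra1) (auto simp: space_PiM)
  from measurable_compose[OF this measurable_component_singleton[of i]] show ?thesis using i by simp
qed

lemma mode_measurable_mode_algebra: "mode \<sigma> \<tau> k \<in> measurable mode_algebra (count_space UNIV)"
proof -
  have "(\<lambda>\<omega> i. mode \<sigma> \<tau> i \<omega>) \<in> measurable mode_algebra (PiM UNIV (\<lambda>_. count_space UNIV))"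
    unfolding mode_algebra_def by (intro measurable_vimage_algebra1) (auto simp: space_PiM)
  from measurable_compose[OF this measurable_component_singleton[of k]] show ?thesis by simp
qed

text \<open>The mode is \<sigma> evaluated at a random time. Its measurability is read off from
  (EH3): \<open>indep_set\<close> demands that the generated sigma-algebras consist of
  events.\<close>

lemma mode_measurable: "mode \<sigma> \<tau> k \<in> measurable M (count_space UNIV)"
proof (rule measurable_from_subalg[OF _ mode_measurable_mode_algebra])
  show "subalgebra M mode_algebra"
    using indep_algebras space_algebras
    unfolding subalgebra_def indep_set_def indep_sets_def by (auto simp: UNIV_bool)
qed

lemma mode_measurable_mode_history:
  "k < j \<Longrightarrow> mode \<sigma> \<tau> k \<in> measurable (mode_history M \<sigma> \<tau> j) (count_space UNIV)"
proof -
  assume k: "k < j"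
  have "(\<lambda>\<omega>. \<lambda>k\<in>{..<j}. mode \<sigma> \<tau> k \<omega>) \<in> measurable (mode_history M \<sigma> \<tau> j) (PiM {..<j} (\<lambda>_. count_space UNIV))"
    unfolding mode_history_def by (intro measurable_vimage_algebra1) (auto simp: space_PiM)
  from measurable_compose[OF this measurable_component_singleton[of k]] show ?thesis using k by simp
qed

lemma subalgebra_mode_history: "subalgebra M (mode_history M \<sigma> \<tau> j)"
proof -
  have "(\<lambda>\<omega>. \<lambda>k\<in>{..<j}. mode \<sigma> \<tau> k \<omega>) \<in> measurable M (PiM {..<j} (\<lambda>_. count_space UNIV))"
    by (intro measurable_restrict mode_measurable)
  then show ?thesis
    unfolding subalgebra_def mode_history_def by (subst (asm) measurable_iff_sets) auto
qed

definition path_event where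
  "path_event n p = {\<omega>\<in>space M. \<forall>k\<in>{..<n}. mode \<sigma> \<tau> k \<omega> = p k}"

text \<open>Chain rule for the mode sequence. The factor at \<open>k = 0\<close> is \<open>1\<close>
  because (EH2) governs the modes from the first switch on only.\<close>

lemma prob_path_event_le:
  assumes p: "\<And>k. k < n \<Longrightarrow> p k \<in> {1..N}"
  shows "prob (path_event n p) \<le> (\<Prod>k<n. if k = 0 then 1 else q (p k))"
  using p
proof (induction n)
  case 0
  then show ?case by simp
next
  case (Suc n)
  show ?case
  proof (cases "n = 0")
    case True
    then show ?thesis by simp
  next
    case False
    let ?H = "mode_history M \<sigma> \<tau> n" and ?I = "{\<omega>\<in>space M. mode \<sigma> \<tau> n \<omega> = p n}"
    interpret H: sigma_finite_subalgebra M ?H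
      by (rule sigma_finite_subalgebra.intro[OF subalgebra_mode_history])
        (use finite_measure_restr_to_subalg[OF subalgebra_mode_history] finite_measure_axioms finite_measure.axioms(1) in blast)
    have AH: "path_event n p \<in> sets ?H"
      unfolding path_event_def
      by (rule mode_path_sets[OF mode_measurable_mode_history]) (auto simp: mode_history_def)
    have AM: "path_event n p \<in> events"
      using AH subalgebra_mode_history by (auto simp: subalgebra_def)
    have IM: "?I \<in> events"
      using measurable_sets[OF mode_measurable[of n], of "{p n}"] by (simp add: vimage_def Int_def conj_commute)
    have "path_event (Suc n) p = path_event n p \<inter> ?I"
      by (auto simp: path_event_def less_Suc_eq)
    then have "prob (path_event (Suc n) p) = (\<integral>\<omega>. indicator (path_event n p) \<omega> * indicator ?I \<omega> \<partial>M)"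
      using AM IM by (simp add: indicator_inter_arith[symmetric])
    also have "\<dots> = (\<integral>\<omega>\<in>path_event n p. indicator ?I \<omega> \<partial>M)"
      by (simp add: set_lebesgue_integral_def)
    \<comment> \<open>The past path is an event of the history, so the indicator of the next mode
      may be replaced by its conditional expectation, which (EH2) makes constant.\<close>
    also have "\<dots> = (\<integral>\<omega>\<in>path_event n p. real_cond_exp M ?H (indicator ?I) \<omega> \<partial>M)"
      using IM AH by (intro H.real_cond_exp_intA integrable_real_indicator) (auto simp: less_top[symmetric])
    also have "\<dots> = (\<integral>\<omega>\<in>path_event n p. q (p n) \<partial>M)"
    proof -
      have "AE \<omega> in M. real_cond_exp M ?H (indicator ?I) \<omega> = q (p n)"
        using EH False Suc.prems[of n] unfolding class_EH_def by auto
      then show ?thesis unfolding set_lebesgue_integral_def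
        using AM by (intro integral_cong_AE) (auto elim!: eventually_mono)
    qed
    also have "\<dots> = prob (path_event n p) * q (p n)"
      using AM by (simp add: set_lebesgue_integral_def)
    also have "\<dots> \<le> (\<Prod>k<n. if k = 0 then 1 else q (p k)) * q (p n)"
      using Suc EH unfolding class_EH_def by (intro mult_right_mono Suc.IH) auto
    finally show ?thesis using False by simp
  qed
qed

text \<open>For a fixed path the indicator belongs to the mode algebra and the product to the
  holding-time algebra. (EH3) separates the two, and (EH1) then separates the factors of the
  product.\<close>

lemma nn_integral_path_le:
  fixes a :: "nat \<Rightarrow> real \<Rightarrow> ennreal"
  assumes a: "\<And>i. a i \<in> borel_measurable borel" and p: "\<And>k. k < n \<Longrightarrow> p k \<in> {1..N}"
    and c: "\<And>i k. i \<in> {1..N} \<Longrightarrow> 1 \<le> k \<Longrightarrow> (\<integral>\<^sup>+\<omega>. a i (holding_time \<tau> k \<omega>) \<partial>M) = c i"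
  shows "(\<integral>\<^sup>+\<omega>. indicator (path_event n p) \<omega> * (\<Prod>k<n. a (p k) (holding_time \<tau> (Suc k) \<omega>)) \<partial>M)
    \<le> (\<Prod>k<n. ennreal (if k = 0 then 1 else q (p k)) * c (p k))"
proof -
  have w0: "0 \<le> (if k = 0 then 1 else q (p k))" if "k < n" for k
    using p[OF that] EH unfolding class_EH_def by auto
  have "(\<integral>\<^sup>+\<omega>. indicator (path_event n p) \<omega> * (\<Prod>k<n. a (p k) (holding_time \<tau> (Suc k) \<omega>)) \<partial>M)
      = emeasure M (path_event n p) * (\<integral>\<^sup>+\<omega>. (\<Prod>k<n. a (p k) (holding_time \<tau> (Suc k) \<omega>)) \<partial>M)"
  proof (rule nn_integral_indicator_mult_indep[OF indep_algebras space_algebras])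
    show "(\<lambda>\<omega>. \<Prod>k<n. a (p k) (holding_time \<tau> (Suc k) \<omega>)) \<in> borel_measurable holding_algebra"
      by (intro borel_measurable_prod_ennreal measurable_compose[OF holding_time_measurable a]) auto
    show "path_event n p \<in> sets mode_algebra"
      unfolding path_event_def by (rule mode_path_sets[OF mode_measurable_mode_algebra space_algebras(2)])
  qed
  also have "(\<integral>\<^sup>+\<omega>. (\<Prod>k<n. a (p k) (holding_time \<tau> (Suc k) \<omega>)) \<partial>M) = (\<Prod>k<n. c (p k))"
    using EH p a unfolding class_EH_def by (subst nn_integral_prod_Suc) (auto intro!: prod.cong c)
  also have "emeasure M (path_event n p) \<le> (\<Prod>k<n. ennreal (if k = 0 then 1 else q (p k)))"
    using prob_path_event_le[OF p, of n] w0
    by (subst prod_ennreal) (auto simp: emeasure_eq_measure intro: ennreal_leI)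
  finally show ?thesis by (simp add: prod.distrib mult_right_mono)
qed

text \<open>Only almost sure: the range of \<sigma> is prescribed at nonnegative times, and the
  instants are nonnegative off a null set.\<close>

lemma AE_mode_in: "AE \<omega> in M. \<forall>k. mode \<sigma> \<tau> k \<omega> \<in> {1..N}"
proof -
  have "AE \<omega> in M. \<tau> 0 \<omega> = 0 \<and> strict_mono (\<lambda>i. \<tau> i \<omega>)"
    using signal unfolding switching_signal_def by auto
  with AE_space show ?thesis
  proof eventually_elim
    case (elim \<omega>)
    have "\<tau> k \<omega> \<ge> 0" for k
      using elim strict_mono_less_eq[of "\<lambda>i. \<tau> i \<omega>" 0 k] by simp
    then have "\<sigma> (\<tau> k \<omega>) \<in> measurable M (count_space {1..N})" for k
      using signal unfolding switching_signal_def by auto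
    from measurable_space[OF this elim(1)] show ?case by (auto simp: mode_def)
  qed
qed

text \<open>The integral is split over the finitely many mode paths. The bound for one path is a
  product over \<open>k\<close>, so the sum over all paths factors into a product of sums; the first
  of these has no weights because the initial mode has none.\<close>

lemma nn_integral_mode_product_le:
  fixes a :: "nat \<Rightarrow> real \<Rightarrow> ennreal"
  assumes a: "\<And>i. a i \<in> borel_measurable borel"
    and c: "\<And>i k. i \<in> {1..N} \<Longrightarrow> 1 \<le> k \<Longrightarrow> (\<integral>\<^sup>+\<omega>. a i (holding_time \<tau> k \<omega>) \<partial>M) = c i"
  shows "(\<integral>\<^sup>+\<omega>. (\<Prod>k<Suc n. a (mode \<sigma> \<tau> k \<omega>) (holding_time \<tau> (Suc k) \<omega>)) \<partial>M)
    \<le> (\<Sum>i\<in>{1..N}. c i) * (\<Sum>i\<in>{1..N}. ennreal (q i) * c i) ^ n"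
proof -
  \<comment> \<open>Extensional functions, so that an outcome with admissible modes matches exactly
    one path, namely \<open>p0\<close> below.\<close>
  let ?P = "PiE {..<Suc n} (\<lambda>_. {1..N})"
  let ?t = "\<lambda>p \<omega>. indicator (path_event (Suc n) p) \<omega> * (\<Prod>k<Suc n. a (p k) (holding_time \<tau> (Suc k) \<omega>))"
  have fin: "finite ?P" by (intro finite_PiE) auto
  have hM: "holding_time \<tau> (Suc k) \<in> borel_measurable M" for k
    using EH unfolding class_EH_def by (auto simp: distributed_def)
  have pM: "path_event (Suc n) p \<in> events" for p
    unfolding path_event_def by (rule mode_path_sets[OF mode_measurable]) auto
  have tM: "?t p \<in> borel_measurable M" for p
    by (rule borel_measurable_times_ennreal[OF borel_measurable_indicator[OF pM]
          borel_measurable_prod_ennreal[OF measurable_compose[OF hM a]]])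
  have "AE \<omega> in M. (\<Prod>k<Suc n. a (mode \<sigma> \<tau> k \<omega>) (holding_time \<tau> (Suc k) \<omega>)) = (\<Sum>p\<in>?P. ?t p \<omega>)"
    using AE_mode_in AE_space
  proof eventually_elim
    case (elim \<omega>)
    define p0 where "p0 = (\<lambda>k\<in>{..<Suc n}. mode \<sigma> \<tau> k \<omega>)"
    have p0: "p0 \<in> ?P" using elim by (auto simp: p0_def)
    have "?t p \<omega> = (if p = p0 then (\<Prod>k<Suc n. a (mode \<sigma> \<tau> k \<omega>) (holding_time \<tau> (Suc k) \<omega>)) else 0)" if "p \<in> ?P" for p
    proof (cases "p = p0")
      case True
      then have "\<omega> \<in> path_event (Suc n) p" using elim by (auto simp: path_event_def p0_def)
      then show ?thesis using True by (auto simp: p0_def intro!: prod.cong simp del: prod.lessThan_Suc)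
    next
      case False
      have "p = p0" if "\<omega> \<in> path_event (Suc n) p"
        by (rule PiE_ext[OF \<open>p \<in> ?P\<close> p0]) (use that in \<open>auto simp: path_event_def p0_def\<close>)
      with False have "\<omega> \<notin> path_event (Suc n) p" by blast
      then show ?thesis using False by simp
    qed
    then have "(\<Sum>p\<in>?P. ?t p \<omega>) = (\<Sum>p\<in>?P. if p = p0 then (\<Prod>k<Suc n. a (mode \<sigma> \<tau> k \<omega>) (holding_time \<tau> (Suc k) \<omega>)) else 0)"
      by (rule sum.cong[OF refl])
    then show ?case using p0 fin by simp
  qed
  then have "(\<integral>\<^sup>+\<omega>. (\<Prod>k<Suc n. a (mode \<sigma> \<tau> k \<omega>) (holding_time \<tau> (Suc k) \<omega>)) \<partial>M) = (\<integral>\<^sup>+\<omega>. (\<Sum>p\<in>?P. ?t p \<omega>) \<partial>M)"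
    by (rule nn_integral_cong_AE)
  also have "\<dots> = (\<Sum>p\<in>?P. \<integral>\<^sup>+\<omega>. ?t p \<omega> \<partial>M)"
    by (rule nn_integral_sum[OF tM])
  also have "\<dots> \<le> (\<Sum>p\<in>?P. \<Prod>k<Suc n. ennreal (if k = 0 then 1 else q (p k)) * c (p k))"
  proof (rule sum_mono)
    fix p assume pP: "p \<in> ?P"
    have p: "p k \<in> {1..N}" if "k < Suc n" for k by (rule PiE_mem[OF pP]) (simp add: that)
    show "(\<integral>\<^sup>+\<omega>. ?t p \<omega> \<partial>M) \<le> (\<Prod>k<Suc n. ennreal (if k = 0 then 1 else q (p k)) * c (p k))"
      by (rule nn_integral_path_le[where a = a and c = c, OF a p c])
  qed
  also have "\<dots> = (\<Prod>k<Suc n. \<Sum>i\<in>{1..N}. ennreal (if k = 0 then 1 else q i) * c i)"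
    by (subst prod_sum_PiE) auto
  also have "\<dots> = (\<Sum>i\<in>{1..N}. c i) * (\<Sum>i\<in>{1..N}. ennreal (q i) * c i) ^ n"
    by (simp add: prod.lessThan_Suc_shift del: prod.lessThan_Suc)
  finally show ?thesis .
qed

lemma AE_mode_product_tendsto_0:
  assumes \<mu>: "0 < \<mu>" and lam: "\<And>i. i \<in> {1..N} \<Longrightarrow> lam i + rate > 0"
    and contr: "(\<Sum>i\<in>{1..N}. \<mu> * q i / (1 + lam i / rate)) < 1"
  shows "AE \<omega> in M. (\<lambda>n. \<Prod>k<n. \<mu> * exp (- lam (mode \<sigma> \<tau> k \<omega>) * holding_time \<tau> (Suc k) \<omega>)) \<longlonglongrightarrow> 0"
proof -
  define Y where "Y n \<omega> = (\<Prod>k<n. \<mu> * exp (- lam (mode \<sigma> \<tau> k \<omega>) * holding_time \<tau> (Suc k) \<omega>))" for n \<omega>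
  \<comment> \<open>\<open>c i\<close> is the expectation of one factor in mode \<open>i\<close>,
    and \<rho> is the sum in (C5).\<close>
  define c where "c i = \<mu> / (1 + lam i / rate)" for i
  define \<rho> where "\<rho> = (\<Sum>i\<in>{1..N}. q i * c i)"
  have rate: "rate > 0" using EH unfolding class_EH_def by simp
  have q0: "0 \<le> q i" if "i \<in> {1..N}" for i using EH that unfolding class_EH_def by simp
  have c0: "0 \<le> c i" if "i \<in> {1..N}" for i
  proof -
    have "1 + lam i / rate = (lam i + rate) / rate" using rate by (simp add: field_simps)
    then show ?thesis using lam[OF that] rate \<mu> by (simp add: c_def)
  qed
  have \<rho>: "0 \<le> \<rho>" "\<rho> < 1"
    using contr q0 c0 unfolding \<rho>_def by (auto intro!: sum_nonneg mult_nonneg_nonneg) (simp add: c_def mult.commute)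
  have hM: "holding_time \<tau> (Suc k) \<in> borel_measurable M" for k
    using EH unfolding class_EH_def by (auto simp: distributed_def)
  \<comment> \<open>The shift is there because the expectation bound concerns products with at least
    one factor, the first belonging to the initial mode.\<close>
  have "AE \<omega> in M. (\<lambda>n. Y (Suc n) \<omega>) \<longlonglongrightarrow> 0"
  proof (rule AE_tendsto_0_of_summable_expectation)
    show "random_variable borel (Y (Suc n))" for n
    proof -
      note [measurable] = hM mode_measurable
      show ?thesis unfolding Y_def by measurable
    qed
    show "0 \<le> Y (Suc n) \<omega>" for n \<omega> using \<mu> by (auto simp: Y_def intro!: prod_nonneg mult_nonneg_nonneg)
    show "0 \<le> (\<Sum>i\<in>{1..N}. c i) * \<rho> ^ n" for n
      using \<rho> c0 by (intro mult_nonneg_nonneg sum_nonneg) auto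
    show "summable (\<lambda>n. (\<Sum>i\<in>{1..N}. c i) * \<rho> ^ n)"
      using \<rho> by (intro summable_mult summable_geometric) auto
    have int: "(\<integral>\<^sup>+\<omega>. ennreal (\<mu> * exp (- lam i * holding_time \<tau> k \<omega>)) \<partial>M) = ennreal (c i)"
      if i: "i \<in> {1..N}" and k: "1 \<le> k" for i k
    proof -
      have hD: "distributed M lborel (holding_time \<tau> k) (exponential_density rate)"
        using EH k unfolding class_EH_def by simp
      have [measurable]: "holding_time \<tau> k \<in> borel_measurable M" using distributed_measurable[OF hD] by simp
      have "(\<integral>\<^sup>+\<omega>. ennreal (\<mu> * exp (- lam i * holding_time \<tau> k \<omega>)) \<partial>M)
          = ennreal \<mu> * (\<integral>\<^sup>+\<omega>. ennreal (exp (- lam i * holding_time \<tau> k \<omega>)) \<partial>M)"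
        using \<mu> by (subst nn_integral_cmult[symmetric]) (auto simp: ennreal_mult)
      also have "\<dots> = ennreal \<mu> * ennreal (1 / (1 + lam i / rate))"
        by (subst nn_integral_exp_exponential[OF hD rate lam[OF i]]) simp
      also have "\<dots> = ennreal (c i)"
        using c0[OF i] \<mu> by (simp add: c_def ennreal_mult'[symmetric])
      finally show ?thesis .
    qed
    fix n
    have "(\<integral>\<^sup>+\<omega>. ennreal (Y (Suc n) \<omega>) \<partial>M)
        = (\<integral>\<^sup>+\<omega>. (\<Prod>k<Suc n. ennreal (\<mu> * exp (- lam (mode \<sigma> \<tau> k \<omega>) * holding_time \<tau> (Suc k) \<omega>))) \<partial>M)"
      using \<mu> unfolding Y_def by (subst prod_ennreal) auto
    also have "\<dots> \<le> (\<Sum>i\<in>{1..N}. ennreal (c i)) * (\<Sum>i\<in>{1..N}. ennreal (q i) * ennreal (c i)) ^ n"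
      by (rule nn_integral_mode_product_le[where a = "\<lambda>i s. ennreal (\<mu> * exp (- lam i * s))" and c = "\<lambda>i. ennreal (c i)"])
        (measurable, rule int)
    also have "(\<Sum>i\<in>{1..N}. ennreal (c i)) = ennreal (\<Sum>i\<in>{1..N}. c i)"
      using c0 by (intro sum_ennreal) auto
    also have "(\<Sum>i\<in>{1..N}. ennreal (q i) * ennreal (c i)) = ennreal \<rho>"
      using c0 q0 unfolding \<rho>_def by (subst sum_ennreal[symmetric]) (auto simp: ennreal_mult intro!: sum.cong)
    also have "ennreal (\<Sum>i\<in>{1..N}. c i) * ennreal \<rho> ^ n = ennreal ((\<Sum>i\<in>{1..N}. c i) * \<rho> ^ n)"
      using \<rho> sum_nonneg[of "{1..N}" c] c0 by (simp add: ennreal_power ennreal_mult)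
    finally show "(\<integral>\<^sup>+\<omega>. ennreal (Y (Suc n) \<omega>) \<partial>M) \<le> ennreal ((\<Sum>i\<in>{1..N}. c i) * \<rho> ^ n)" .
  qed
  then have "AE \<omega> in M. (\<lambda>n. Y n \<omega>) \<longlonglongrightarrow> 0"
  proof eventually_elim
    case (elim \<omega>)
    then show ?case by (rule LIMSEQ_imp_Suc[of "\<lambda>n. Y n \<omega>"])
  qed
  then show ?thesis by (simp add: Y_def)
qed

text \<open>\<open>switching_signal\<close> makes the instants increase but not diverge. Here
  \<open>exp (- \<tau> n \<omega>)\<close> is the product of the independent factors
  \<open>exp (- S)\<close>, each of expectation \<open>r < 1\<close>, so it tends to
  \<open>0\<close> almost surely.\<close>

lemma AE_switching_instants_at_top: "AE \<omega> in M. filterlim (\<lambda>n. \<tau> n \<omega>) at_top sequentially"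
proof -
  have rate: "rate > 0" using EH unfolding class_EH_def by simp
  have hM: "holding_time \<tau> (Suc k) \<in> borel_measurable M" for k
    using EH unfolding class_EH_def by (auto simp: distributed_def)
  define r where "r = 1 / (1 + 1 / rate)"
  have r: "0 \<le> r" "r < 1" using rate by (auto simp: r_def field_simps)
  have int: "(\<integral>\<^sup>+\<omega>. ennreal (exp (- holding_time \<tau> (Suc k) \<omega>)) \<partial>M) = ennreal r" for k
    using nn_integral_exp_exponential[of "holding_time \<tau> (Suc k)" rate 1] EH rate
    unfolding class_EH_def r_def by simp
  have "AE \<omega> in M. (\<lambda>n. \<Prod>k<n. exp (- holding_time \<tau> (Suc k) \<omega>)) \<longlonglongrightarrow> 0"
  proof (rule AE_tendsto_0_of_summable_expectation[where e = "\<lambda>n. r ^ n"])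
    show "random_variable borel (\<lambda>\<omega>. \<Prod>k<n. exp (- holding_time \<tau> (Suc k) \<omega>))" for n
    proof -
      note [measurable] = hM
      show ?thesis by measurable
    qed
    have "(\<integral>\<^sup>+\<omega>. ennreal (\<Prod>k<n. exp (- holding_time \<tau> (Suc k) \<omega>)) \<partial>M)
        = (\<integral>\<^sup>+\<omega>. (\<Prod>k<n. ennreal (exp (- holding_time \<tau> (Suc k) \<omega>))) \<partial>M)" for n
      by (subst prod_ennreal) auto
    also have "\<dots> n = (\<Prod>k<n. \<integral>\<^sup>+\<omega>. ennreal (exp (- holding_time \<tau> (Suc k) \<omega>)) \<partial>M)" for n
      using EH unfolding class_EH_def by (intro nn_integral_prod_Suc[where a = "\<lambda>_ s. ennreal (exp (- s))"]) auto
    finally show "(\<integral>\<^sup>+\<omega>. ennreal (\<Prod>k<n. exp (- holding_time \<tau> (Suc k) \<omega>)) \<partial>M) \<le> ennreal (r ^ n)" for n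
      using r by (simp add: int ennreal_power)
  qed (use r in \<open>auto intro!: prod_nonneg\<close>)
  moreover have "AE \<omega> in M. \<tau> 0 \<omega> = 0"
    using signal unfolding switching_signal_def by auto
  ultimately show ?thesis
  proof eventually_elim
    case (elim \<omega>)
    have "(\<Prod>k<n. exp (- holding_time \<tau> (Suc k) \<omega>)) = exp (- \<tau> n \<omega>)" for n
      using elim(2) by (induction n) (auto simp: holding_time_def exp_add[symmetric])
    then have lim: "(\<lambda>n. exp (- \<tau> n \<omega>)) \<longlonglongrightarrow> 0" using elim(1) by simp
    show ?case unfolding filterlim_at_top
    proof
      fix Z
      have "\<forall>\<^sub>F n in sequentially. exp (- \<tau> n \<omega>) < exp (- Z)"
        using order_tendstoD(2)[OF lim, of "exp (- Z)"] by simp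
      then show "\<forall>\<^sub>F n in sequentially. Z \<le> \<tau> n \<omega>" by (auto elim!: eventually_mono)
    qed
  qed
qed

end
end

subsection \<open>Switched systems along a fixed path\<close>

lemma bounded_vector_derivative_imp_lipschitz_on:
  fixes x :: "real \<Rightarrow> 'a::real_normed_vector"
  assumes der: "\<And>t. t \<in> {a..b} \<Longrightarrow> (x has_vector_derivative x' t) (at t within {a..b})"
    and B: "\<And>t. t \<in> {a..b} \<Longrightarrow> norm (x' t) \<le> B" "0 \<le> B"
  shows "B-lipschitz_on {a..b} x"
proof (rule lipschitz_onI[OF _ B(2)])
  fix u v assume uv: "u \<in> {a..b}" "v \<in> {a..b}"
  have "norm (x u - x v) \<le> B * norm (u - v)"
  proof (rule differentiable_bound[where f = x and B = B and S = "{a..b}" and f' = "\<lambda>t h. h *\<^sub>R x' t"])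
    show "(x has_derivative (\<lambda>h. h *\<^sub>R x' t)) (at t within {a..b})" if "t \<in> {a..b}" for t
      using der[OF that] by (simp add: has_vector_derivative_def)
    show "onorm (\<lambda>h. h *\<^sub>R x' t) \<le> B" if "t \<in> {a..b}" for t
    proof (rule onorm_le)
      show "norm (h *\<^sub>R x' t) \<le> B * norm h" for h
        using mult_left_mono[OF B(1)[OF that], of "\<bar>h\<bar>"] by (simp add: mult.commute)
    qed
  qed (use uv in auto)
  then show "dist (x u) (x v) \<le> B * dist u v" by (simp add: dist_norm)
qed

text \<open>The field is cut off outside a large ball. Since the cut-off factor lies in \<open>[0, 1]\<close>, the
  Lyapunov estimate survives with rate \<open>\<bar>c\<bar>\<close> and keeps the solution inside the ball.\<close>

lemma lyapunov_solution_exists: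
  fixes F :: "'a::euclidean_space \<Rightarrow> 'a"
  assumes F: "continuous_on UNIV F" and V: "twice_cont_diff V" and V0: "\<And>y. 0 \<le> V y"
    and Lie: "\<And>y. Lie_deriv F V y \<le> c * V y"
    and proper: "\<And>C. \<exists>R. \<forall>y. V y \<le> C \<longrightarrow> norm y \<le> R"
    and T: "0 \<le> T"
  obtains x where "x 0 = z"
    "\<And>t. t \<in> {0..T} \<Longrightarrow> (x has_vector_derivative F (x t)) (at t within {0..T})"
proof -
  \<comment> \<open>\<open>C\<close> is the largest value that the estimate with rate
    \<open>\<bar>c\<bar>\<close> allows up to time \<open>T\<close>, and \<open>R\<close> is a
    radius for its sublevel set. The cut-off is \<open>1\<close> on that ball, so the solution found
    never meets the modified part of the field.\<close>
  define C where "C = exp (\<bar>c\<bar> * T) * V z"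
  obtain R where R: "\<And>y. V y \<le> C \<Longrightarrow> norm y \<le> R" using proper[of C] by blast
  define cut where "cut y = max 0 (min 1 (R + 1 - norm y))" for y :: 'a
  define G where "G y = cut y *\<^sub>R F y" for y
  have cut: "0 \<le> cut y" "cut y \<le> 1" for y by (auto simp: cut_def)
  have "continuous_on UNIV cut" unfolding cut_def[abs_def] by (intro continuous_intros)
  then have G: "continuous_on UNIV G"
    unfolding G_def[abs_def] using F by (intro continuous_on_scaleR)
  have "compact (F ` cball 0 (R + 1))"
    using F by (intro compact_continuous_image) (auto intro: continuous_on_subset)
  then have "bounded (F ` cball 0 (R + 1))" by (rule compact_imp_bounded)
  then obtain B where B: "B > 0" "\<forall>w\<in>F ` cball 0 (R + 1). norm w \<le> B" unfolding bounded_pos by blast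
  have GB: "norm (G y) \<le> B" for y
  proof (cases "norm y \<le> R + 1")
    case True
    then have "norm (F y) \<le> B" using B(2) by auto
    then have "cut y * norm (F y) \<le> 1 * B" using cut[of y] by (intro mult_mono) auto
    then show ?thesis using cut[of y] by (simp add: G_def)
  next
    case False
    then show ?thesis using B(1) by (simp add: G_def cut_def)
  qed
  obtain x where x0: "x 0 = z"
    and x: "\<And>t. t \<in> {0..T} \<Longrightarrow> (x has_vector_derivative G (x t)) (at t within {0..T})"
    using peano_existence[OF G GB T] by metis
  have LieG: "Lie_deriv G V y \<le> \<bar>c\<bar> * V y" for y
  proof -
    have "c * V y \<le> \<bar>c\<bar> * V y" using V0 by (intro mult_right_mono) auto
    then have L: "Lie_deriv F V y \<le> \<bar>c\<bar> * V y" using Lie[of y] by simp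
    have "Lie_deriv G V y = cut y * Lie_deriv F V y" by (simp add: Lie_deriv_def G_def)
    also have "\<dots> \<le> cut y * (\<bar>c\<bar> * V y)"
      using cut(1) by (intro mult_left_mono L)
    also have "\<dots> \<le> 1 * (\<bar>c\<bar> * V y)" using V0[of y] cut(2) by (intro mult_right_mono) auto
    finally show ?thesis by simp
  qed
  have inside: "norm (x t) \<le> R" if t: "t \<in> {0..T}" for t
  proof -
    have xt: "(x has_vector_derivative G (x r)) (at r within {0..t})" if "r \<in> {0..t}" for r
      by (rule has_vector_derivative_within_subset[OF x]) (use that t in auto)
    have ac: "abs_continuous_on {0..t} x"
      by (rule lipschitz_imp_abs_continuous_on, rule bounded_vector_derivative_imp_lipschitz_on[OF xt GB])
        (use B in auto)
    have "V (x t) \<le> exp (\<bar>c\<bar> * (t - 0)) * V (x 0)"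
      by (rule lyapunov_decay[where F = G and E = "{}", OF V ac]) (use t xt LieG in auto)
    also have "\<dots> \<le> C" unfolding C_def x0 using t V0[of z] by (intro mult_right_mono) (auto intro!: mult_left_mono)
    finally show ?thesis by (rule R)
  qed
  show ?thesis
  proof (rule that[of x])
    fix t assume t: "t \<in> {0..T}"
    have "cut (x t) = 1" using inside[OF t] by (simp add: cut_def)
    then show "(x has_vector_derivative F (x t)) (at t within {0..T})"
      using x[OF t] by (simp add: G_def)
  qed (rule x0)
qed

text \<open>Collects what holds along almost every path, so that the remaining arguments are
  deterministic. Divergence of \<tau> makes the intervals cover all nonnegative times.\<close>

locale switching_path =
  fixes \<tau> :: "nat \<Rightarrow> real" and s :: "real \<Rightarrow> 'i" and m :: "nat \<Rightarrow> 'i"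
  assumes \<tau>0: "\<tau> 0 = 0" and mono: "strict_mono \<tau>" and top: "filterlim \<tau> at_top sequentially"
    and s: "\<And>n t. \<tau> n \<le> t \<Longrightarrow> t < \<tau> (Suc n) \<Longrightarrow> s t = m n"
begin

lemma \<tau>_le: "i \<le> j \<Longrightarrow> \<tau> i \<le> \<tau> j"
  using mono by (simp add: strict_mono_less_eq)

lemma \<tau>_nonneg: "0 \<le> \<tau> i"
  using \<tau>_le[of 0 i] \<tau>0 by simp

lemma ex_ge: "\<exists>n. T \<le> \<tau> n"
  using top unfolding filterlim_at_top by (auto simp: eventually_sequentially)

lemma interval_exists:
  assumes "0 \<le> t"
  obtains n where "\<tau> n \<le> t" "t < \<tau> (Suc n)"
proof -
  have ex: "\<exists>n. t < \<tau> (Suc n)"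
    using ex_ge[of "t + 1"] \<tau>_le[OF le_SucI[OF order_refl]] by (meson less_add_one less_le_trans order_trans)
  define n where "n = (LEAST n. t < \<tau> (Suc n))"
  have lt: "t < \<tau> (Suc n)" unfolding n_def by (rule LeastI_ex[OF ex])
  have "\<tau> n \<le> t"
  proof (cases n)
    case 0
    then show ?thesis using assms \<tau>0 by simp
  next
    case (Suc k)
    then have "k < n" by simp
    then have "\<not> t < \<tau> (Suc k)" unfolding n_def by (rule not_less_Least)
    then show ?thesis using Suc by simp
  qed
  with lt show ?thesis by (rule that[rotated])
qed

lemma interval_unique:
  assumes "\<tau> n \<le> t" "t < \<tau> (Suc n)" "\<tau> k \<le> t" "t < \<tau> (Suc k)"
  shows "n = k"
proof (rule ccontr)
  assume "n \<noteq> k"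
  then have "Suc n \<le> k \<or> Suc k \<le> n" by linarith
  then show False using assms \<tau>_le[of "Suc n" k] \<tau>_le[of "Suc k" n] by linarith
qed

text \<open>Solutions on the holding intervals, translated in time, are chained: each starts where
  the previous one ends. The result is Lipschitz on bounded intervals, which gives absolute
  continuity across the instants.\<close>

lemma caratheodory_solution_exists:
  fixes F :: "'i \<Rightarrow> 'a::euclidean_space \<Rightarrow> 'a"
  assumes F: "\<And>n. continuous_on UNIV (F (m n))"
    and sol: "\<And>n z T. 0 \<le> T \<Longrightarrow> \<exists>x. x 0 = z \<and>
      (\<forall>t\<in>{0..T}. (x has_vector_derivative F (m n) (x t)) (at t within {0..T}))"
  shows "\<exists>x. caratheodory_solution F s x0 x"
proof -
  have "\<exists>x. x (\<tau> n) = z \<and>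
      (\<forall>t\<in>{\<tau> n..\<tau> (Suc n)}. (x has_vector_derivative F (m n) (x t)) (at t within {\<tau> n..\<tau> (Suc n)}))" for n z
  proof -
    have T: "0 \<le> \<tau> (Suc n) - \<tau> n" using \<tau>_le[of n "Suc n"] by simp
    obtain x where x: "x 0 = z"
      "\<And>t. t \<in> {0..\<tau> (Suc n) - \<tau> n} \<Longrightarrow> (x has_vector_derivative F (m n) (x t)) (at t within {0..\<tau> (Suc n) - \<tau> n})"
      using sol[OF T, of z n] by blast
    have "((x \<circ> (\<lambda>t. t - \<tau> n)) has_vector_derivative 1 *\<^sub>R F (m n) (x (t - \<tau> n))) (at t within {\<tau> n..\<tau> (Suc n)})"
      if t: "t \<in> {\<tau> n..\<tau> (Suc n)}" for t
    proof (rule vector_diff_chain_within)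
      show "((\<lambda>t. t - \<tau> n) has_vector_derivative 1) (at t within {\<tau> n..\<tau> (Suc n)})"
        by (auto intro!: derivative_eq_intros)
      show "(x has_vector_derivative F (m n) (x (t - \<tau> n))) (at (t - \<tau> n) within (\<lambda>t. t - \<tau> n) ` {\<tau> n..\<tau> (Suc n)})"
        by (rule has_vector_derivative_within_subset[OF x(2)]) (use t in auto)
    qed
    then show ?thesis using x(1) by (intro exI[of _ "x \<circ> (\<lambda>t. t - \<tau> n)"]) auto
  qed
  then obtain sl where sl0: "\<And>n z. sl n z (\<tau> n) = z"
    and sl: "\<And>n z t. t \<in> {\<tau> n..\<tau> (Suc n)} \<Longrightarrow>
        (sl n z has_vector_derivative F (m n) (sl n z t)) (at t within {\<tau> n..\<tau> (Suc n)})"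
    by metis
  define X where "X = rec_nat x0 (\<lambda>n z. sl n z (\<tau> (Suc n)))"
  have X: "X 0 = x0" "\<And>n. X (Suc n) = sl n (X n) (\<tau> (Suc n))" by (auto simp: X_def)
  define x where "x t = (let n = (THE n. \<tau> n \<le> t \<and> t < \<tau> (Suc n)) in sl n (X n) t)" for t
  have x': "x t = sl n (X n) t" if "\<tau> n \<le> t" "t < \<tau> (Suc n)" for n t
  proof -
    have "(THE n. \<tau> n \<le> t \<and> t < \<tau> (Suc n)) = n"
      using that interval_unique by (intro the_equality) auto
    then show ?thesis by (simp add: x_def)
  qed
  \<comment> \<open>At the right end point the definition already selects the next piece; the two
    agree there since \<open>X (Suc n)\<close> is the end value of piece \<open>n\<close>.\<close>
  have x: "x t = sl n (X n) t" if "t \<in> {\<tau> n..\<tau> (Suc n)}" for n t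
  proof (cases "t = \<tau> (Suc n)")
    case True
    have "\<tau> (Suc n) < \<tau> (Suc (Suc n))" using mono by (simp add: strict_mono_less)
    then show ?thesis using x'[of "Suc n" t] True X(2)[of n] sl0[of "Suc n" "X (Suc n)"] by simp
  qed (use x'[of n t] that in auto)
  have der: "(x has_vector_derivative F (m n) (x t)) (at t within {\<tau> n..\<tau> (Suc n)})"
    if "t \<in> {\<tau> n..\<tau> (Suc n)}" for n t
    by (rule has_vector_derivative_transform[OF that x]) (use sl[OF that, of "X n"] x[OF that] in simp_all)
  have piece: "\<exists>L. L-lipschitz_on {\<tau> n..\<tau> (Suc n)} x" for n
  proof -
    have "continuous_on {\<tau> n..\<tau> (Suc n)} x"
      using der by (meson continuous_on_vector_derivative)
    then have "continuous_on {\<tau> n..\<tau> (Suc n)} (\<lambda>t. F (m n) (x t))"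
      using continuous_on_compose2[OF F] by blast
    then have "compact ((\<lambda>t. F (m n) (x t)) ` {\<tau> n..\<tau> (Suc n)})"
      by (intro compact_continuous_image) auto
    then have "bounded ((\<lambda>t. F (m n) (x t)) ` {\<tau> n..\<tau> (Suc n)})" by (rule compact_imp_bounded)
    then obtain B where "B > 0" "\<forall>w\<in>(\<lambda>t. F (m n) (x t)) ` {\<tau> n..\<tau> (Suc n)}. norm w \<le> B"
      unfolding bounded_pos by blast
    then have "B-lipschitz_on {\<tau> n..\<tau> (Suc n)} x"
      by (intro bounded_vector_derivative_imp_lipschitz_on[OF der]) auto
    then show ?thesis by blast
  qed
  have lip: "\<exists>L. L-lipschitz_on {0..\<tau> n} x" for n
  proof (induction n)
    case 0
    then show ?case by (auto simp: \<tau>0 intro: exI[of _ 0])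
  next
    case (Suc n)
    obtain L L' where L: "L-lipschitz_on {0..\<tau> n} x" "L'-lipschitz_on {\<tau> n..\<tau> (Suc n)} x"
      using Suc piece[of n] by blast
    \<comment> \<open>The branches coincide; the conditional only matches the form of the
      concatenation rule.\<close>
    have "(max L L')-lipschitz_on {0..\<tau> (Suc n)} (\<lambda>t. if t \<le> \<tau> n then x t else x t)"
      by (rule lipschitz_on_concat) (use L in \<open>auto intro: lipschitz_on_le\<close>)
    then show ?case by auto
  qed
  have "caratheodory_solution F s x0 x"
    unfolding caratheodory_solution_def
  proof (intro conjI allI impI)
    show "x 0 = x0" using x[of 0 0] \<tau>0 \<tau>_nonneg[of 1] sl0[of 0 x0] X(1) by simp
    show "abs_continuous_on {0..T} x" if "0 \<le> T" for T
    proof -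
      obtain n where "T \<le> \<tau> n" using ex_ge by blast
      moreover obtain L where "L-lipschitz_on {0..\<tau> n} x" using lip by blast
      ultimately show ?thesis
        by (intro abs_continuous_on_subset[OF lipschitz_imp_abs_continuous_on]) auto
    qed
    \<comment> \<open>At a switching instant only one-sided derivatives are at hand, but these
      instants are countably many.\<close>
    have "range \<tau> \<in> null_sets lebesgue"
      by (intro null_sets_completionI countable_imp_null_set_lborel) auto
    then have "AE t in lebesgue. t \<notin> range \<tau>" by (rule AE_not_in)
    then have "AE t in lebesgue. t \<in> {0..} \<longrightarrow> (x has_vector_derivative F (s t) (x t)) (at t)"
    proof eventually_elim
      case (elim t)
      show ?case
      proof
        assume "t \<in> {0..}"
        then obtain n where n: "\<tau> n \<le> t" "t < \<tau> (Suc n)" using interval_exists[of t] by auto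
        moreover have "t \<noteq> \<tau> n" using elim by auto
        ultimately have "t \<in> {\<tau> n<..<\<tau> (Suc n)}" by auto
        then have "at t within {\<tau> n..\<tau> (Suc n)} = at t"
          by (intro at_within_interior) simp
        then show "(x has_vector_derivative F (s t) (x t)) (at t)"
          using der[of t n] n s[OF n] by simp
      qed
    qed
    then show "AE t in lebesgue_on {0..}. (x has_vector_derivative F (s t) (x t)) (at t)"
      by (subst AE_restrict_space_iff) auto
  qed
  then show ?thesis by blast
qed

section \<open>Lyapunov estimates along an arbitrary solution\<close>

context
  fixes V :: "'i \<Rightarrow> 'a::euclidean_space \<Rightarrow> real" and F :: "'i \<Rightarrow> 'a \<Rightarrow> 'a" and \<mu> :: real and lam :: "'i \<Rightarrow> real"
    and x0 :: 'a and x :: "real \<Rightarrow> 'a" and Y :: "nat \<Rightarrow> real"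
  assumes V: "\<And>n. twice_cont_diff (V (m n))" and V0: "\<And>n y. 0 \<le> V (m n) y"
    and comp: "\<And>n k y. V (m n) y \<le> \<mu> * V (m k) y" and \<mu>: "1 \<le> \<mu>"
    and Lie: "\<And>n y. Lie_deriv (F (m n)) (V (m n)) y \<le> - lam (m n) * V (m n) y"
    and sol: "caratheodory_solution F s x0 x"
    and Y: "\<And>n. Y n = (\<Prod>k<n. \<mu> * exp (- lam (m k) * (\<tau> (Suc k) - \<tau> k)))"
begin

lemma lyapunov_decay_interval:
  assumes t: "\<tau> n \<le> t" "t \<le> \<tau> (Suc n)"
  shows "V (m n) (x t) \<le> exp (- lam (m n) * (t - \<tau> n)) * V (m n) (x (\<tau> n))"
proof -
  have "AE r in lebesgue. r \<in> {0..} \<longrightarrow> (x has_vector_derivative F (s r) (x r)) (at r)"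
    using sol unfolding caratheodory_solution_def by (subst (asm) AE_restrict_space_iff) auto
  then obtain E where E: "negligible E"
    "\<And>r. r \<notin> E \<Longrightarrow> 0 \<le> r \<Longrightarrow> (x has_vector_derivative F (s r) (x r)) (at r)"
    unfolding eventually_ae_filter_negligible by auto
  show ?thesis
  \<comment> \<open>The right end point joins the exceptional set because the signal may already
    have left mode \<open>m n\<close> there.\<close>
  proof (rule lyapunov_decay[where F = "F (m n)" and E = "insert (\<tau> (Suc n)) E", OF V])
    show "abs_continuous_on {\<tau> n..t} x"
      using sol t \<tau>_nonneg[of n] unfolding caratheodory_solution_def
      by (auto intro: abs_continuous_on_subset[of "{0..t}"])
    show "(x has_vector_derivative F (m n) (x r)) (at r within {\<tau> n..t})"
      if "r \<in> {\<tau> n..t} - insert (\<tau> (Suc n)) E" for r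
      using that E(2)[of r] s[of n r] t \<tau>_nonneg[of n] by (auto intro: has_vector_derivative_at_within)
  qed (use t E(1) Lie in auto)
qed

text \<open>The state is continuous at a switch, so changing the Lyapunov function costs exactly the
  factor \<mu>, and each holding interval contributes its exponential.\<close>

lemma lyapunov_at_instants: "V (m n) (x (\<tau> n)) \<le> Y n * V (m 0) x0"
proof (induction n)
  case 0
  then show ?case using sol by (simp add: Y \<tau>0 caratheodory_solution_def)
next
  case (Suc n)
  have "V (m (Suc n)) (x (\<tau> (Suc n))) \<le> \<mu> * V (m n) (x (\<tau> (Suc n)))" by (rule comp)
  also have "\<dots> \<le> \<mu> * (exp (- lam (m n) * (\<tau> (Suc n) - \<tau> n)) * V (m n) (x (\<tau> n)))"
    using \<mu> \<tau>_le[of n "Suc n"] by (intro mult_left_mono lyapunov_decay_interval) auto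
  also have "\<dots> \<le> \<mu> * (exp (- lam (m n) * (\<tau> (Suc n) - \<tau> n)) * (Y n * V (m 0) x0))"
    using \<mu> Suc by (intro mult_left_mono) auto
  also have "\<dots> = Y (Suc n) * V (m 0) x0" by (simp add: Y mult_ac)
  finally show ?case .
qed

text \<open>As the sign of the rate is open, the exponential at an intermediate time is bounded by
  the sum of its end values, \<open>1\<close> and the full factor. The latter times
  \<open>Y n\<close> is at most \<open>Y (Suc n)\<close>, which has the additional factor
  \<mu>.\<close>

lemma lyapunov_bound:
  assumes t: "\<tau> n \<le> t" "t \<le> \<tau> (Suc n)"
  shows "V (m n) (x t) \<le> (Y n + Y (Suc n)) * V (m 0) x0"
proof -
  let ?l = "lam (m n)" and ?S = "\<tau> (Suc n) - \<tau> n"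
  have Y0: "0 \<le> Y n" using \<mu> by (auto simp: Y intro!: prod_nonneg)
  have e: "exp (- ?l * (t - \<tau> n)) \<le> 1 + exp (- ?l * ?S)"
  proof (cases "0 \<le> ?l")
    case True
    then have "exp (- ?l * (t - \<tau> n)) \<le> 1" using t by (simp add: mult_nonneg_nonneg)
    then show ?thesis by (simp add: add_increasing2)
  next
    case False
    then have "exp (- ?l * (t - \<tau> n)) \<le> exp (- ?l * ?S)"
      using t by (simp add: mult_left_mono_neg)
    then show ?thesis by (rule order_trans) simp
  qed
  have "V (m n) (x t) \<le> exp (- ?l * (t - \<tau> n)) * V (m n) (x (\<tau> n))"
    by (rule lyapunov_decay_interval[OF t])
  also have "\<dots> \<le> (1 + exp (- ?l * ?S)) * (Y n * V (m 0) x0)"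
    by (intro mult_mono e lyapunov_at_instants V0) (simp add: add_nonneg_nonneg)
  also have "\<dots> = (Y n + exp (- ?l * ?S) * Y n) * V (m 0) x0" by (simp add: algebra_simps)
  also have "\<dots> \<le> (Y n + \<mu> * (exp (- ?l * ?S) * Y n)) * V (m 0) x0"
    using V0[of 0 x0] Y0 mult_right_mono[OF \<mu>, of "exp (- ?l * ?S) * Y n"] by (intro mult_right_mono) auto
  also have "\<mu> * (exp (- ?l * ?S) * Y n) = Y (Suc n)" by (simp add: Y mult_ac)
  finally show ?thesis .
qed

end

text \<open>Boundedness of \<open>D\<close> gives (AS1) and convergence of \<open>D\<close> to
  \<open>0\<close> gives (AS2). \<open>D\<close> is fixed before \<open>x0\<close>, hence the
  uniformity in the initial state.\<close>

lemma class_K_bound_imp_stability: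
  fixes P :: "'a::real_normed_vector \<Rightarrow> (real \<Rightarrow> 'a) \<Rightarrow> bool"
  assumes K: "class_K \<alpha>1" "class_K \<alpha>2" and D: "D \<longlonglongrightarrow> 0" "\<And>n. 0 \<le> D n"
    and bnd: "\<And>x0 x n t. P x0 x \<Longrightarrow> \<tau> n \<le> t \<Longrightarrow> t < \<tau> (Suc n) \<Longrightarrow> \<alpha>1 (norm (x t)) \<le> D n * \<alpha>2 (norm x0)"
  shows "\<forall>\<epsilon>>0. \<exists>\<delta>>0. \<forall>x0 x. P x0 x \<longrightarrow> norm x0 < \<delta> \<longrightarrow> (SUP t\<in>{0..}. ereal (norm (x t))) < ereal \<epsilon>"
    and "\<forall>r>0. \<forall>\<epsilon>>0. \<exists>T\<ge>0. \<forall>x0 x. P x0 x \<longrightarrow> norm x0 < r \<longrightarrow> (SUP t\<in>{T..}. ereal (norm (x t))) < ereal \<epsilon>"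
proof -
  have inc1: "\<alpha>1 a < \<alpha>1 b" if "0 \<le> a" "a < b" for a b
    using K(1) that unfolding class_K_def by (auto simp: strict_mono_on_def)
  have inc2: "\<alpha>2 a < \<alpha>2 b" if "0 \<le> a" "a < b" for a b
    using K(2) that unfolding class_K_def by (auto simp: strict_mono_on_def)
  have zero: "\<alpha>1 0 = 0" "\<alpha>2 0 = 0" using K by (auto simp: class_K_def)
  have pos2: "0 \<le> \<alpha>2 a" if "0 \<le> a" for a using inc2[of 0 a] zero that by (cases "a = 0") auto
  \<comment> \<open>Working with \<open>\<epsilon> / 2\<close> keeps the inequality strict after
    taking the supremum.\<close>
  have sup: "(SUP t\<in>S. ereal (norm (x t))) < ereal \<epsilon>"
    if \<epsilon>: "\<epsilon> > 0" and le: "\<And>t. t \<in> S \<Longrightarrow> \<alpha>1 (norm (x t)) \<le> \<alpha>1 (\<epsilon> / 2)" for S x \<epsilon>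
  proof -
    have "norm (x t) \<le> \<epsilon> / 2" if "t \<in> S" for t
      using le[OF that] inc1[of "\<epsilon> / 2" "norm (x t)"] \<epsilon> by (cases "norm (x t) \<le> \<epsilon> / 2") auto
    then have "(SUP t\<in>S. ereal (norm (x t))) \<le> ereal (\<epsilon> / 2)" by (intro SUP_least) simp
    also have "\<dots> < ereal \<epsilon>" using \<epsilon> by simp
    finally show ?thesis .
  qed
  show "\<forall>\<epsilon>>0. \<exists>\<delta>>0. \<forall>x0 x. P x0 x \<longrightarrow> norm x0 < \<delta> \<longrightarrow> (SUP t\<in>{0..}. ereal (norm (x t))) < ereal \<epsilon>"
  proof (intro allI impI)
    fix \<epsilon> :: real assume \<epsilon>: "\<epsilon> > 0"
    have "bounded (range D)" using D(1) by (simp add: convergent_imp_bounded)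
    then obtain B where "B > 0" "\<forall>w\<in>range D. norm w \<le> B" unfolding bounded_pos by blast
    then have B: "B > 0" "\<And>n. D n \<le> B" using D(2) by auto
    \<comment> \<open>Chosen so that \<open>B * \<eta>\<close> equals
      \<open>\<alpha>1 (\<epsilon> / 2)\<close>; continuity of \<open>\<alpha>2\<close> at
      \<open>0\<close> then supplies \<delta>.\<close>
    define \<eta> where "\<eta> = \<alpha>1 (\<epsilon> / 2) / B"
    have \<eta>: "\<eta> > 0" using inc1[of 0 "\<epsilon> / 2"] zero \<epsilon> B(1) by (simp add: \<eta>_def)
    have cont: "continuous_on {0..} \<alpha>2" using K(2) by (simp add: class_K_def)
    obtain \<delta> where d: "\<delta> > 0" "\<forall>a\<in>{0..}. dist a 0 < \<delta> \<longrightarrow> dist (\<alpha>2 a) (\<alpha>2 0) < \<eta>"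
      using cont[unfolded continuous_on_iff, rule_format, of 0 \<eta>] \<eta> by auto
    have \<delta>: "\<alpha>2 a < \<eta>" if "0 \<le> a" "a < \<delta>" for a
      using d(2)[rule_format, of a] that zero(2) by (simp add: dist_real_def)
    show "\<exists>\<delta>>0. \<forall>x0 x. P x0 x \<longrightarrow> norm x0 < \<delta> \<longrightarrow> (SUP t\<in>{0..}. ereal (norm (x t))) < ereal \<epsilon>"
    proof (intro exI[of _ \<delta>] conjI allI impI d(1) sup[OF \<epsilon>])
      fix x0 x t assume P: "P x0 x" and x0: "norm x0 < \<delta>" and "t \<in> {0::real..}"
      then obtain n where n: "\<tau> n \<le> t" "t < \<tau> (Suc n)" using interval_exists[of t] by auto
      have "\<alpha>1 (norm (x t)) \<le> D n * \<alpha>2 (norm x0)" by (rule bnd[OF P n])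
      also have "\<dots> \<le> B * \<eta>"
        using B \<delta>[of "norm x0"] x0 pos2[of "norm x0"] D(2) by (intro mult_mono) auto
      also have "\<dots> = \<alpha>1 (\<epsilon> / 2)" using B(1) by (simp add: \<eta>_def)
      finally show "\<alpha>1 (norm (x t)) \<le> \<alpha>1 (\<epsilon> / 2)" .
    qed
  qed
  show "\<forall>r>0. \<forall>\<epsilon>>0. \<exists>T\<ge>0. \<forall>x0 x. P x0 x \<longrightarrow> norm x0 < r \<longrightarrow> (SUP t\<in>{T..}. ereal (norm (x t))) < ereal \<epsilon>"
  proof (intro allI impI)
    fix r \<epsilon> :: real assume r: "r > 0" and \<epsilon>: "\<epsilon> > 0"
    have \<alpha>r: "\<alpha>2 r > 0" using inc2[of 0 r] zero r by simp
    have "\<alpha>1 (\<epsilon> / 2) / \<alpha>2 r > 0" using inc1[of 0 "\<epsilon> / 2"] zero \<epsilon> \<alpha>r by simp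
    then have "\<forall>\<^sub>F n in sequentially. D n < \<alpha>1 (\<epsilon> / 2) / \<alpha>2 r" by (rule order_tendstoD(2)[OF D(1)])
    then obtain n0 where n0: "\<And>n. n \<ge> n0 \<Longrightarrow> D n * \<alpha>2 r < \<alpha>1 (\<epsilon> / 2)"
      using \<alpha>r by (auto simp: eventually_sequentially pos_less_divide_eq)
    show "\<exists>T\<ge>0. \<forall>x0 x. P x0 x \<longrightarrow> norm x0 < r \<longrightarrow> (SUP t\<in>{T..}. ereal (norm (x t))) < ereal \<epsilon>"
    \<comment> \<open>Times from \<open>\<tau> n0\<close> on lie in intervals of index at least
      \<open>n0\<close>, where \<open>D n\<close> is small enough.\<close>
    proof (intro exI[of _ "\<tau> n0"] conjI allI impI \<tau>_nonneg sup[OF \<epsilon>])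
      fix x0 x t assume P: "P x0 x" and x0: "norm x0 < r" and t: "t \<in> {\<tau> n0..}"
      then obtain n where n: "\<tau> n \<le> t" "t < \<tau> (Suc n)" using interval_exists[of t] \<tau>_nonneg[of n0] by auto
      have "n0 \<le> n" using \<tau>_le[of "Suc n" n0] n t by (cases "n0 \<le> n") auto
      have "\<alpha>1 (norm (x t)) \<le> D n * \<alpha>2 (norm x0)" by (rule bnd[OF P n])
      also have "\<dots> \<le> D n * \<alpha>2 r" using inc2[of "norm x0" r] x0 D(2) by (intro mult_left_mono) auto
      also have "\<dots> \<le> \<alpha>1 (\<epsilon> / 2)" using n0[OF \<open>n0 \<le> n\<close>] by simp
      finally show "\<alpha>1 (norm (x t)) \<le> \<alpha>1 (\<epsilon> / 2)" .
    qed
  qed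
qed

end

subsection \<open>Almost sure stability\<close>

theorem theorem7p1:
  fixes M :: "'w measure"
    and N \<sigma>0 :: nat
    and \<sigma> :: "real \<Rightarrow> 'w \<Rightarrow> nat"
    and \<tau> :: "nat \<Rightarrow> 'w \<Rightarrow> real"
    and f :: "nat \<Rightarrow> real^'n \<Rightarrow> real^'n"
    and g :: "nat \<Rightarrow> 'm::finite \<Rightarrow> real^'n \<Rightarrow> real^'n"
    and V :: "nat \<Rightarrow> real^'n \<Rightarrow> real"
    and rate \<mu> :: real
    and q lam :: "nat \<Rightarrow> real"
  assumes prob: "prob_space M"
    and complete: "complete_measure M"
    and signal: "switching_signal M N \<sigma> \<sigma>0 \<tau>"
    and EH: "class_EH M N \<sigma> \<tau> rate q"
    and f: "\<And>i. i \<in> {1..N} \<Longrightarrow> twice_cont_diff (f i) \<and> f i 0 = 0"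
    and g: "\<And>i j. i \<in> {1..N} \<Longrightarrow> twice_cont_diff (g i j) \<and> g i j 0 = 0"
    and V: "\<And>i. i \<in> {1..N} \<Longrightarrow> twice_cont_diff (V i)"
    and C1: "\<exists>\<alpha>1 \<alpha>2. class_K_inf \<alpha>1 \<and> class_K_inf \<alpha>2 \<and>
               (\<forall>i\<in>{1..N}. \<forall>x. \<alpha>1 (norm x) \<le> V i x \<and> V i x \<le> \<alpha>2 (norm x))"
    and C2: "\<mu> > 1" "\<And>i j x. i \<in> {1..N} \<Longrightarrow> j \<in> {1..N} \<Longrightarrow> V i x \<le> \<mu> * V j x"
    and C3: "\<And>i x. i \<in> {1..N} \<Longrightarrow> x \<noteq> 0 \<Longrightarrow>
               (INF u::real^'m. ereal (Lie_deriv (f i) (V i) x + lam i * V i x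
                  + (\<Sum>j\<in>UNIV. u $ j * Lie_deriv (g i j) (V i) x))) < 0"
    and C4: "\<And>\<epsilon>. \<epsilon> > 0 \<Longrightarrow> \<exists>\<delta>>0. \<forall>x. x \<noteq> 0 \<longrightarrow> norm x < \<delta> \<longrightarrow>
               (\<exists>u::real^'m. norm u < \<epsilon> \<and>
                  (\<forall>i\<in>{1..N}. Lie_deriv (f i) (V i) x
                     + (\<Sum>j\<in>UNIV. u $ j * Lie_deriv (g i j) (V i) x) \<le> - lam i * V i x))"
    and C5: "\<And>i. i \<in> {1..N} \<Longrightarrow> lam i + rate > 0"
            "(\<Sum>i\<in>{1..N}. \<mu> * q i / (1 + lam i / rate)) < 1"
  shows "GAS_almost_surely M (closed_loop f g (feedback f g V lam)) \<sigma>"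
proof -
  interpret prob_space M by (rule prob)
  let ?F = "closed_loop f g (feedback f g V lam)"
  obtain \<alpha>1 \<alpha>2 where \<alpha>: "class_K_inf \<alpha>1" "class_K_inf \<alpha>2"
    and bounds: "\<And>i x. i \<in> {1..N} \<Longrightarrow> \<alpha>1 (norm x) \<le> V i x \<and> V i x \<le> \<alpha>2 (norm x)"
    using C1 by blast
  have inc: "\<alpha>1 a < \<alpha>1 b" if "0 \<le> a" "a < b" for a b
    using \<alpha>(1) that unfolding class_K_inf_def class_K_def by (auto simp: strict_mono_on_def)
  have zero: "\<alpha>1 0 = 0" "\<alpha>2 0 = 0" using \<alpha> by (auto simp: class_K_inf_def class_K_def)
  have \<alpha>1_nonneg: "0 \<le> \<alpha>1 (norm y)" for y :: "real^'n"
    using inc[of 0 "norm y"] zero by (cases "y = 0") auto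
  have V0: "0 \<le> V i y" if "i \<in> {1..N}" for i y
    using bounds[OF that, of y] \<alpha>1_nonneg[of y] by linarith
  have proper: "\<exists>R. \<forall>y. V i y \<le> C \<longrightarrow> norm y \<le> R" if i: "i \<in> {1..N}" for i C
  proof -
    obtain R where R: "R \<ge> 0" "C < \<alpha>1 R"
      using \<alpha>(1) unfolding class_K_inf_def bdd_above_def by (auto simp: not_le)
    have "norm y \<le> R" if "V i y \<le> C" for y
      using bounds[OF i, of y] inc[of R "norm y"] R that by (cases "norm y \<le> R") auto
    then show ?thesis by blast
  qed
  \<comment> \<open>When \<open>W_tilde\<close> vanishes, all coefficients of the control in (C3)
    are \<open>0\<close>, and the infimum is taken over a constant.\<close>
  have neg: "W_bar f V lam i x < 0" if i: "i \<in> {1..N}" and x: "x \<noteq> 0" and W: "W_tilde g V i x = 0" for i x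
  proof -
    obtain u :: "real^'m" where "Lie_deriv (f i) (V i) x + lam i * V i x
        + (\<Sum>j\<in>UNIV. u $ j * Lie_deriv (g i j) (V i) x) < 0"
      using C3[OF i x] by (auto simp: INF_less_iff zero_ereal_def)
    then show ?thesis using W by (simp add: W_tilde_eq_0_iff W_bar_def)
  qed
  have Lie: "Lie_deriv (?F i) (V i) y \<le> - lam i * V i y" if i: "i \<in> {1..N}" for i y
  proof (rule Lie_deriv_feedback_le)
    assume W: "W_tilde g V i y = 0"
    \<comment> \<open>(C3) leaves out the origin; there (C1) forces \<open>V i\<close> to vanish,
      and \<open>f i\<close> vanishes as well.\<close>
    show "W_bar f V lam i y \<le> 0"
    proof (cases "y = 0")
      case True
      then have "V i y = 0" using bounds[OF i, of y] zero by simp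
      then show ?thesis using True f[OF i] by (simp add: W_bar_def Lie_deriv_def)
    qed (use neg[OF i _ W] in simp)
  qed
  obtain \<delta> where \<delta>: "\<delta> > 0" and small: "\<And>x. x \<noteq> 0 \<Longrightarrow> norm x < \<delta> \<Longrightarrow>
      \<exists>u::real^'m. norm u < 1 \<and> (\<forall>i\<in>{1..N}. Lie_deriv (f i) (V i) x
        + (\<Sum>j\<in>UNIV. u $ j * Lie_deriv (g i j) (V i) x) \<le> - lam i * V i x)"
    using C4[of 1] by auto
  have cont: "continuous_on UNIV (?F i)" if i: "i \<in> {1..N}" for i
  proof (rule continuous_on_closed_loop_feedback[OF _ _ _ _ V[OF i] neg[OF i] \<delta>])
    fix x :: "real^'n" assume "x \<noteq> 0" "norm x < \<delta>"
    from small[OF this] obtain u :: "real^'m" where "norm u < 1"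
      "Lie_deriv (f i) (V i) x + (\<Sum>j\<in>UNIV. u $ j * Lie_deriv (g i j) (V i) x) \<le> - lam i * V i x"
      using i by blast
    then show "\<exists>u::real^'m. norm u < 1 \<and>
        W_bar f V lam i x + (\<Sum>j\<in>UNIV. u $ j * Lie_deriv (g i j) (V i) x) \<le> 0"
      by (intro exI[of _ u]) (simp add: W_bar_def)
  qed (use f[OF i] g[OF i] in \<open>auto intro: twice_cont_diff_continuous_on\<close>)
  define Y where "Y \<omega> n = (\<Prod>k<n. \<mu> * exp (- lam (mode \<sigma> \<tau> k \<omega>) * (\<tau> (Suc k) \<omega> - \<tau> k \<omega>)))" for \<omega> n
  have \<mu>: "0 < \<mu>" "1 \<le> \<mu>" using C2(1) by auto
  have Y0: "0 \<le> Y \<omega> n" for \<omega> n unfolding Y_def using \<mu> by (intro prod_nonneg) auto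
  have signal': "AE \<omega> in M. \<tau> 0 \<omega> = 0 \<and> strict_mono (\<lambda>i. \<tau> i \<omega>) \<and>
      (\<forall>i. \<forall>t\<in>{\<tau> i \<omega>..<\<tau> (Suc i) \<omega>}. \<sigma> t \<omega> = \<sigma> (\<tau> i \<omega>) \<omega>)"
    using signal unfolding switching_signal_def by blast
  have prod0: "AE \<omega> in M. (\<lambda>n. \<Prod>k<n. \<mu> * exp (- lam (mode \<sigma> \<tau> k \<omega>) * holding_time \<tau> (Suc k) \<omega>)) \<longlonglongrightarrow> 0"
    by (rule AE_mode_product_tendsto_0[OF signal EH \<mu>(1)]) (use C5 in auto)
  \<comment> \<open>None of these properties mentions \<open>x0\<close>, so the exceptional null set
    is common to all initial states.\<close>
  have good: "AE \<omega> in M. switching_path (\<lambda>n. \<tau> n \<omega>) (\<lambda>t. \<sigma> t \<omega>) (\<lambda>n. mode \<sigma> \<tau> n \<omega>) \<and>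
      (\<forall>n. mode \<sigma> \<tau> n \<omega> \<in> {1..N}) \<and> Y \<omega> \<longlonglongrightarrow> 0"
    using signal' AE_switching_instants_at_top[OF signal EH] AE_mode_in[OF signal EH] prod0
  proof eventually_elim
    case (elim \<omega>)
    then have "switching_path (\<lambda>n. \<tau> n \<omega>) (\<lambda>t. \<sigma> t \<omega>) (\<lambda>n. mode \<sigma> \<tau> n \<omega>)"
      by unfold_locales (auto simp: mode_def)
    moreover have "Y \<omega> \<longlonglongrightarrow> 0" using elim(4) by (simp add: Y_def[abs_def] holding_time_def)
    ultimately show ?case using elim(3) by blast
  qed
  have bnd: "\<alpha>1 (norm (x t)) \<le> (Y \<omega> n + Y \<omega> (Suc n)) * \<alpha>2 (norm x0)"
    if sp: "switching_path (\<lambda>n. \<tau> n \<omega>) (\<lambda>t. \<sigma> t \<omega>) (\<lambda>n. mode \<sigma> \<tau> n \<omega>)"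
      and m: "\<And>n. mode \<sigma> \<tau> n \<omega> \<in> {1..N}"
      and sol: "caratheodory_solution ?F (\<lambda>t. \<sigma> t \<omega>) x0 x"
      and t: "\<tau> n \<omega> \<le> t" "t < \<tau> (Suc n) \<omega>" for \<omega> x0 x n t
  proof -
    interpret switching_path "\<lambda>n. \<tau> n \<omega>" "\<lambda>t. \<sigma> t \<omega>" "\<lambda>n. mode \<sigma> \<tau> n \<omega>" by (rule sp)
    have "\<alpha>1 (norm (x t)) \<le> V (mode \<sigma> \<tau> n \<omega>) (x t)" using bounds[OF m] by blast
    also have "\<dots> \<le> (Y \<omega> n + Y \<omega> (Suc n)) * V (mode \<sigma> \<tau> 0 \<omega>) x0"
      by (rule lyapunov_bound[where F = ?F and V = V and lam = lam and \<mu> = \<mu>,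
            OF V[OF m] V0[OF m] C2(2)[OF m m] \<mu>(2) Lie[OF m] sol])
        (use t in \<open>auto simp: Y_def\<close>)
    also have "\<dots> \<le> (Y \<omega> n + Y \<omega> (Suc n)) * \<alpha>2 (norm x0)"
      using bounds[OF m] Y0 by (intro mult_left_mono add_nonneg_nonneg) auto
    finally show ?thesis .
  qed
  have stable: "(\<forall>\<epsilon>>0. \<exists>\<delta>>0. \<forall>x0 x. caratheodory_solution ?F (\<lambda>t. \<sigma> t \<omega>) x0 x \<longrightarrow>
        norm x0 < \<delta> \<longrightarrow> (SUP t\<in>{0..}. ereal (norm (x t))) < ereal \<epsilon>) \<and>
      (\<forall>r>0. \<forall>\<epsilon>>0. \<exists>T\<ge>0. \<forall>x0 x. caratheodory_solution ?F (\<lambda>t. \<sigma> t \<omega>) x0 x \<longrightarrow>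
        norm x0 < r \<longrightarrow> (SUP t\<in>{T..}. ereal (norm (x t))) < ereal \<epsilon>)"
    if sp: "switching_path (\<lambda>n. \<tau> n \<omega>) (\<lambda>t. \<sigma> t \<omega>) (\<lambda>n. mode \<sigma> \<tau> n \<omega>)"
      and m: "\<And>n. mode \<sigma> \<tau> n \<omega> \<in> {1..N}" and Ylim: "Y \<omega> \<longlonglongrightarrow> 0" for \<omega>
  proof -
    interpret switching_path "\<lambda>n. \<tau> n \<omega>" "\<lambda>t. \<sigma> t \<omega>" "\<lambda>n. mode \<sigma> \<tau> n \<omega>" by (rule sp)
    have "(\<lambda>n. Y \<omega> n + Y \<omega> (Suc n)) \<longlonglongrightarrow> 0"
      using tendsto_add[OF Ylim LIMSEQ_Suc[OF Ylim]] by simp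
    moreover have "0 \<le> Y \<omega> n + Y \<omega> (Suc n)" for n using Y0 by (simp add: add_nonneg_nonneg)
    moreover have "class_K \<alpha>1" "class_K \<alpha>2" using \<alpha> by (auto simp: class_K_inf_def)
    ultimately show ?thesis
      using class_K_bound_imp_stability[where P = "caratheodory_solution ?F (\<lambda>t. \<sigma> t \<omega>)"
          and D = "\<lambda>n. Y \<omega> n + Y \<omega> (Suc n)" and ?\<alpha>1.0 = \<alpha>1 and ?\<alpha>2.0 = \<alpha>2] bnd[OF sp m]
      by blast
  qed
  show ?thesis
    unfolding GAS_almost_surely_def
  proof (intro conjI)
    show "AE \<omega> in M. \<forall>x0. \<exists>x. caratheodory_solution ?F (\<lambda>t. \<sigma> t \<omega>) x0 x"
      using good
    proof eventually_elim
      case (elim \<omega>)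
      interpret switching_path "\<lambda>n. \<tau> n \<omega>" "\<lambda>t. \<sigma> t \<omega>" "\<lambda>n. mode \<sigma> \<tau> n \<omega>" using elim by blast
      show ?case
      proof (intro allI caratheodory_solution_exists)
        fix n z and T :: real
        have i: "mode \<sigma> \<tau> n \<omega> \<in> {1..N}" using elim by blast
        show "continuous_on UNIV (?F (mode \<sigma> \<tau> n \<omega>))" by (rule cont[OF i])
        assume T: "0 \<le> T"
        show "\<exists>x. x 0 = z \<and> (\<forall>t\<in>{0..T}. (x has_vector_derivative ?F (mode \<sigma> \<tau> n \<omega>) (x t)) (at t within {0..T}))"
          using lyapunov_solution_exists[OF cont[OF i] V[OF i] V0[OF i] Lie[OF i] proper[OF i] T, of z]
          by metis
      qed
    qed
  qed (use good in \<open>eventually_elim, use stable in blast\<close>)+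
qed

end
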